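(* Let $a>-1$, $|b|<1$ and $|b|<1+a$. Then $$[B^{a,b},B^{a,b}]^{(a,b)}_t=\kappa_{a,b}\,t^{1+a+b},\qquad t\ge0,$$ where $\kappa_{a,b}=\dfrac1{(1+b)\mathbb B(a+1,b+1)}$.
   Context: For $a>-1$, $|b|<1$, $|b|<a+1$, the weighted fractional Brownian motion $B^{a,b}=(B^{a,b}_t)_{t\ge 0}$ is a continuous centered Gaussian process with $B^{a,b}_0=0$ and covariance $$E[B^{a,b}_tB^{a,b}_s]=\frac{1}{2\mathbb B(a+1,b+1)}\int_0^{s\wedge t}u^a\big((t-u)^b+(s-u)^b\big)\,du,$$ where $\mathbb B(\cdot,\cdot)$ is the Beta function. (The paper assumes $b\ne0$ throughout for simplicity.) For a Borel function $f$ and $\varepsilon>0$ put $$J_\varepsilon(f,t)=\frac{1+a+b}{\varepsilon^{1+b}}\int_\varepsilon^{t+\varepsilon}\{f(B^{a,b}_{s+\varepsilon})-f(B^{a,b}_s)\}(B^{a,b}_{s+\varepsilon}-B^{a,b}_s)s^b\,ds .$$ The generalized quadratic covariation is $[f(B^{a,b}),B^{a,b}]^{(a,b)}_t=\lim_{\varepsilon\downarrow0}J_\varepsilon(f,t)$, provided the limit exists uniformly in probability (uniformly in $t$ on compact intervals, in probability). $[B^{a,b},B^{a,b}]^{(a,b)}$ is the case $f(x)=x$; the assertion includes existence of the limit. *)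

theory Defs
  imports "HOL-Probability.Probability"
begin

text \<open>Degenerate (constant) laws count as Gaussian; the case \<open>\<sigma> = 0\<close> has to be
  separated because \<^const>\<open>normal_density\<close> is identically 0 there.\<close>

definition gaussian_rv :: "'a measure \<Rightarrow> ('a \<Rightarrow> real) \<Rightarrow> bool" where
  "gaussian_rv M X \<longleftrightarrow> X \<in> borel_measurable M \<and>
     (\<exists>\<mu> \<sigma>. (\<sigma> = 0 \<and> distr M borel X = return borel \<mu>) \<or>
            (\<sigma> > 0 \<and> distributed M lborel X (\<lambda>x. ennreal (normal_density \<mu> \<sigma> x))))"

text \<open>Processes are indexed by \<open>[0,\<infinity>)\<close>; values at negative times are irrelevant.\<close>

definition gaussian_process :: "'a measure \<Rightarrow> (real \<Rightarrow> 'a \<Rightarrow> real) \<Rightarrow> bool" where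
  "gaussian_process M X \<longleftrightarrow>
     (\<forall>T c. finite T \<and> T \<subseteq> {0..} \<longrightarrow> gaussian_rv M (\<lambda>\<omega>. \<Sum>t\<in>T. c t * X t \<omega>))"

definition weighted_fBm :: "real \<Rightarrow> real \<Rightarrow> 'a measure \<Rightarrow> (real \<Rightarrow> 'a \<Rightarrow> real) \<Rightarrow> bool" where
  "weighted_fBm a b M B \<longleftrightarrow>
     gaussian_process M B \<and>
     (\<forall>\<omega>\<in>space M. continuous_on {0..} (\<lambda>t. B t \<omega>)) \<and>
     (\<forall>\<omega>\<in>space M. B 0 \<omega> = 0) \<and>
     (\<forall>t\<ge>0. (\<integral>\<omega>. B t \<omega> \<partial>M) = 0) \<and>
     (\<forall>t\<ge>0. \<forall>s\<ge>0. (\<integral>\<omega>. B t \<omega> * B s \<omega> \<partial>M) =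
        1 / (2 * Beta (a + 1) (b + 1)) *
        (LBINT u:{0..min s t}. u powr a * ((t - u) powr b + (s - u) powr b)))"

text \<open>Uniform convergence in probability on compact time intervals as \<open>\<epsilon> \<down> 0\<close>.
  The event is ``\<open>sup\<^sub>t\<^sub>\<in>\<^sub>[\<^sub>0\<^sub>,\<^sub>T\<^sub>] \<bar>Y \<epsilon> t - L t\<bar> > \<delta>\<close>'', written without \<^const>\<open>Sup\<close>, which is
  unspecified on unbounded sets of reals. Its measurability is required explicitly because
  \<^const>\<open>measure\<close> is 0 on non-measurable sets.\<close>

definition ucp_limit ::
    "'a measure \<Rightarrow> (real \<Rightarrow> real \<Rightarrow> 'a \<Rightarrow> real) \<Rightarrow> (real \<Rightarrow> 'a \<Rightarrow> real) \<Rightarrow> bool" where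
  "ucp_limit M Y L \<longleftrightarrow>
     (\<forall>T\<ge>0. \<forall>\<delta>>0.
        (\<forall>\<^sub>F \<epsilon> in at_right 0. {\<omega> \<in> space M. \<exists>t\<in>{0..T}. \<bar>Y \<epsilon> t \<omega> - L t \<omega>\<bar> > \<delta>} \<in> sets M) \<and>
        ((\<lambda>\<epsilon>. measure M {\<omega> \<in> space M. \<exists>t\<in>{0..T}. \<bar>Y \<epsilon> t \<omega> - L t \<omega>\<bar> > \<delta>}) \<longlongrightarrow> 0)
          (at_right 0))"

definition J_approx ::
    "real \<Rightarrow> real \<Rightarrow> (real \<Rightarrow> 'a \<Rightarrow> real) \<Rightarrow> (real \<Rightarrow> real) \<Rightarrow> real \<Rightarrow> real \<Rightarrow> 'a \<Rightarrow> real" where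
  "J_approx a b B f \<epsilon> t \<omega> =
     (1 + a + b) / \<epsilon> powr (1 + b) *
     (LBINT s:{\<epsilon>..t + \<epsilon>}.
        (f (B (s + \<epsilon>) \<omega>) - f (B s \<omega>)) * (B (s + \<epsilon>) \<omega> - B s \<omega>) * s powr b)"

text \<open>The covariation \<open>[f(B),B]\<close> exists and equals the process \<open>L\<close>.\<close>

definition has_gen_quad_cov ::
    "real \<Rightarrow> real \<Rightarrow> 'a measure \<Rightarrow> (real \<Rightarrow> 'a \<Rightarrow> real) \<Rightarrow> (real \<Rightarrow> real) \<Rightarrow>
     (real \<Rightarrow> 'a \<Rightarrow> real) \<Rightarrow> bool" where
  "has_gen_quad_cov a b M B f L \<longleftrightarrow>
     f \<in> borel_measurable borel \<and> ucp_limit M (J_approx a b B f) L"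

definition kappa :: "real \<Rightarrow> real \<Rightarrow> real" where
  "kappa a b = 1 / ((1 + b) * Beta (a + 1) (b + 1))"

end

theory Submission
  imports Defs
begin

text \<open>
  For \<open>f(x) = x\<close> the approximation \<open>J\<^sub>\<epsilon>(t)\<close> is a weighted integral of the squared increments
  \<open>X\<^sub>s = B\<^sub>s\<^sub>+\<^sub>\<epsilon> - B\<^sub>s\<close>. It is shown to converge in \<open>L\<^sup>2\<close> for each fixed \<open>t\<close> by computing its mean
  and its variance, and the convergence is then made uniform in \<open>t\<close> by monotonicity.

  \<^bold>\<open>Mean.\<close> In the variance of an increment all parts of the covariance cancel except
  \<open>E X\<^sub>s\<^sup>2 = (1/\<B>) \<integral>\<^bsub>s\<^esub>\<^bsup>s+\<epsilon>\<^esup> u\<^sup>a (s+\<epsilon>-u)\<^sup>b du\<close> (\<open>V_eq_wint\<close>), where \<open>\<B>\<close> is the Beta value at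
  \<open>(a+1, b+1)\<close>. As \<open>u\<^sup>a\<close> is nearly constant on \<open>[s, s+\<epsilon>]\<close>, this is
  asymptotic to \<open>\<kappa> s\<^sup>a \<epsilon>\<^bsup>1+b\<^esup>\<close>. For \<open>s \<ge> \<epsilon>\<close> it is also at most a constant multiple of
  \<open>s\<^sup>a \<epsilon>\<^bsup>1+b\<^esup>\<close>; the range of integration in \<open>J\<^sub>\<epsilon>\<close> starts at \<open>\<epsilon>\<close> so that this holds. Hence the
  integrands of the mean are dominated by a multiple of \<open>s\<^bsup>a+b\<^esup>\<close>, which is integrable at 0 because
  \<open>\<bar>b\<bar> < 1 + a\<close>, and \<open>E J\<^sub>\<epsilon>(t) \<rightarrow> (1+a+b) \<kappa> \<integral>\<^bsub>0\<^esub>\<^bsup>t\<^esup> s\<^bsup>a+b\<^esup> ds = \<kappa> t\<^bsup>1+a+b\<^esup>\<close>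
  (\<open>J_mean_tendsto\<close>).

  \<^bold>\<open>Variance.\<close> For centered jointly Gaussian variables \<open>Cov(X\<^sup>2, Y\<^sup>2) = 2 Cov(X, Y)\<^sup>2\<close>
  (\<open>isserlis_squares\<close>), so the variance of \<open>J\<^sub>\<epsilon>(t)\<close> is a double integral of squared covariances of
  increments (\<open>weighted_quadratic_functional_moments\<close>). By the Cauchy-Schwarz inequality it is
  dominated by the product of the majorants used for the mean. Off the diagonal
  \<open>Cov(X\<^sub>s, X\<^sub>r)\<close> is \<open>O(\<epsilon>\<^sup>2)\<close>, one factor \<open>\<epsilon>\<close> coming from the length of an interval and the other
  from a difference of \<open>b\<close>-th powers, while the normalisation is \<open>\<epsilon>\<^bsup>1+b\<^esup>\<close> with \<open>b < 1\<close>. So the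
  integrand tends to 0 almost everywhere, and the variance tends to 0 (\<open>J_variance_tendsto\<close>).

  \<^bold>\<open>Uniformity.\<close> \<open>J\<^sub>\<epsilon>\<close> is nondecreasing in \<open>t\<close> and the limit is a continuous deterministic function,
  so control on a finite grid gives control on \<open>[0, T]\<close> (\<open>ucp_limit_of_mono\<close>).
\<close>

section \<open>Gaussian moments\<close>

text \<open>A degenerate centered law is the point mass at 0, for which the relation reads \<open>0 = 0\<close>.\<close>

lemma centered_gaussian_moments:
  fixes X :: "'a \<Rightarrow> real"
  assumes "prob_space M" "gaussian_rv M X" "(\<integral>\<omega>. X \<omega> \<partial>M) = 0"
  shows integrable_power_gaussian: "integrable M (\<lambda>\<omega>. X \<omega> ^ k)"
    and gaussian_fourth_moment: "(\<integral>\<omega>. X \<omega> ^ 4 \<partial>M) = 3 * (\<integral>\<omega>. (X \<omega>)\<^sup>2 \<partial>M)\<^sup>2"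
proof -
  interpret prob_space M by fact
  have X[measurable]: "X \<in> borel_measurable M"
    using assms(2) by (simp add: gaussian_rv_def)
  consider \<mu> where "distr M borel X = return borel \<mu>"
    | \<mu> \<sigma> where "\<sigma> > 0" "distributed M lborel X (\<lambda>x. ennreal (normal_density \<mu> \<sigma> x))"
    using assms(2) by (auto simp: gaussian_rv_def)
  then have "integrable M (\<lambda>\<omega>. X \<omega> ^ k) \<and>
      (\<integral>\<omega>. X \<omega> ^ 4 \<partial>M) = 3 * (\<integral>\<omega>. (X \<omega>)\<^sup>2 \<partial>M)\<^sup>2"
  proof cases
    case (1 \<mu>)
    have E: "(\<integral>\<omega>. X \<omega> ^ n \<partial>M) = \<mu> ^ n" for n
    proof -
      have "(\<integral>\<omega>. X \<omega> ^ n \<partial>M) = (\<integral>x. x ^ n \<partial>distr M borel X)"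
        by (subst integral_distr) auto
      also have "\<dots> = \<mu> ^ n"
        unfolding 1 by (subst integral_return) auto
      finally show ?thesis .
    qed
    have "AE x in distr M borel X. x = \<mu>"
      unfolding 1 by (subst AE_return) auto
    then have "AE \<omega> in M. X \<omega> = \<mu>"
      by (subst (asm) AE_distr_iff) auto
    then have "integrable M (\<lambda>\<omega>. X \<omega> ^ k)"
      by (intro integrable_cong_AE[THEN iffD2, OF _ _ _ integrable_const[of "\<mu> ^ k"]]) auto
    moreover have "\<mu> = 0"
      using E[of 1] assms(3) by simp
    ultimately show ?thesis by (simp add: E)
  next
    case (2 \<mu> \<sigma>)
    have I: "integrable M (\<lambda>\<omega>. g (X \<omega>)) = integrable lborel (\<lambda>x. normal_density \<mu> \<sigma> x * g x)"
      and E: "(\<integral>\<omega>. g (X \<omega>) \<partial>M) = (\<integral>x. normal_density \<mu> \<sigma> x * g x \<partial>lborel)"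
      if "g \<in> borel_measurable borel" for g :: "real \<Rightarrow> real"
      using distributed_integrable[OF 2(2)] distributed_integral[OF 2(2)] that by auto
    have \<mu>: "\<mu> = 0"
      using E[of "\<lambda>x. x"] integral_normal_moment_nz_1[OF 2(1), of \<mu>] assms(3) by simp
    have m2: "(\<integral>x. normal_density 0 \<sigma> x * x\<^sup>2 \<partial>lborel) = \<sigma>\<^sup>2"
      using integral_normal_moment_even[OF 2(1), of 0 1] by simp
    have m4: "(\<integral>x. normal_density 0 \<sigma> x * x ^ 4 \<partial>lborel) = 3 * \<sigma> ^ 4"
      using integral_normal_moment_even[OF 2(1), of 0 2]
      by (simp add: fact_numeral power_divide flip: power_mult)
    show ?thesis
      using I[of "\<lambda>x. x ^ k"] integrable_normal_moment[OF 2(1), of \<mu> k]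
        E[of "\<lambda>x. x ^ 4"] E[of "\<lambda>x. x\<^sup>2"] \<mu>
      by (simp add: m2 m4 flip: power_mult)
  qed
  then show "integrable M (\<lambda>\<omega>. X \<omega> ^ k)"
    and "(\<integral>\<omega>. X \<omega> ^ 4 \<partial>M) = 3 * (\<integral>\<omega>. (X \<omega>)\<^sup>2 \<partial>M)\<^sup>2" by auto
qed

text \<open>
  The hypothesis only concerns the laws of linear combinations, so \<open>X\<^sup>2Y\<^sup>2\<close> is recovered by polarization,
  \<open>12 X\<^sup>2Y\<^sup>2 = (X+Y)\<^sup>4 + (X-Y)\<^sup>4 - 2X\<^sup>4 - 2Y\<^sup>4\<close>, and every fourth moment on the right is three times
  the squared variance of the corresponding linear combination.
\<close>

lemma isserlis_squares:
  fixes X Y :: "'a \<Rightarrow> real"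
  assumes M: "prob_space M"
    and g: "\<And>p q. gaussian_rv M (\<lambda>\<omega>. p * X \<omega> + q * Y \<omega>)"
    and X0: "(\<integral>\<omega>. X \<omega> \<partial>M) = 0" and Y0: "(\<integral>\<omega>. Y \<omega> \<partial>M) = 0"
  shows "integrable M (\<lambda>\<omega>. X \<omega> * Y \<omega>)"
    and "integrable M (\<lambda>\<omega>. (X \<omega>)\<^sup>2 * (Y \<omega>)\<^sup>2)"
    and "(\<integral>\<omega>. (X \<omega>)\<^sup>2 * (Y \<omega>)\<^sup>2 \<partial>M) =
      (\<integral>\<omega>. (X \<omega>)\<^sup>2 \<partial>M) * (\<integral>\<omega>. (Y \<omega>)\<^sup>2 \<partial>M) + 2 * (\<integral>\<omega>. X \<omega> * Y \<omega> \<partial>M)\<^sup>2"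
proof -
  interpret prob_space M by fact
  have gX: "gaussian_rv M X" and gY: "gaussian_rv M Y"
    using g[of 1 0] g[of 0 1] by simp_all
  note iX = integrable_power_gaussian[OF M gX X0] and iY = integrable_power_gaussian[OF M gY Y0]
  have i1: "integrable M X" "integrable M Y" using iX[of 1] iY[of 1] by simp_all
  let ?S = "\<lambda>q \<omega>. X \<omega> + q * Y \<omega>"
  have gS: "gaussian_rv M (?S q)" for q using g[of 1 q] by simp
  have S0: "(\<integral>\<omega>. ?S q \<omega> \<partial>M) = 0" for q using i1 X0 Y0 by simp
  note iS = integrable_power_gaussian[OF M gS S0] and fS = gaussian_fourth_moment[OF M gS S0]
  have XY: "X \<omega> * Y \<omega> = ((?S 1 \<omega>)\<^sup>2 - (?S (- 1) \<omega>)\<^sup>2) / 4" for \<omega>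
    by (simp add: power2_eq_square algebra_simps)
  show iXY: "integrable M (\<lambda>\<omega>. X \<omega> * Y \<omega>)"
    unfolding XY by (intro integrable_divide Bochner_Integration.integrable_diff iS)
  have XXYY: "(X \<omega>)\<^sup>2 * (Y \<omega>)\<^sup>2 = (?S 1 \<omega> ^ 4 + ?S (- 1) \<omega> ^ 4 - 2 * X \<omega> ^ 4 - 2 * Y \<omega> ^ 4) / 12" for \<omega>
    by (simp add: power2_eq_square power4_eq_xxxx algebra_simps)
  show "integrable M (\<lambda>\<omega>. (X \<omega>)\<^sup>2 * (Y \<omega>)\<^sup>2)"
    unfolding XXYY
    by (intro integrable_divide Bochner_Integration.integrable_diff Bochner_Integration.integrable_add
        integrable_mult_right iS iX iY)
  let ?VX = "\<integral>\<omega>. (X \<omega>)\<^sup>2 \<partial>M" and ?VY = "\<integral>\<omega>. (Y \<omega>)\<^sup>2 \<partial>M" and ?C = "\<integral>\<omega>. X \<omega> * Y \<omega> \<partial>M"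
  have VS: "(\<integral>\<omega>. (?S q \<omega>)\<^sup>2 \<partial>M) = ?VX + 2 * q * ?C + q\<^sup>2 * ?VY" for q
  proof -
    have "(?S q \<omega>)\<^sup>2 = (X \<omega>)\<^sup>2 + 2 * q * (X \<omega> * Y \<omega>) + q\<^sup>2 * (Y \<omega>)\<^sup>2" for \<omega>
      by (simp add: power2_eq_square algebra_simps)
    then show ?thesis using iX[of 2] iY[of 2] iXY by simp
  qed
  have "(\<integral>\<omega>. (X \<omega>)\<^sup>2 * (Y \<omega>)\<^sup>2 \<partial>M) =
     ((\<integral>\<omega>. ?S 1 \<omega> ^ 4 \<partial>M) + (\<integral>\<omega>. ?S (- 1) \<omega> ^ 4 \<partial>M) - 2 * (\<integral>\<omega>. X \<omega> ^ 4 \<partial>M) - 2 * (\<integral>\<omega>. Y \<omega> ^ 4 \<partial>M)) / 12"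
    unfolding XXYY using iS[of 1 4] iS[of "-1" 4] iX[of 4] iY[of 4] by simp
  also have "\<dots> = ?VX * ?VY + 2 * ?C\<^sup>2"
    unfolding fS VS gaussian_fourth_moment[OF M gX X0] gaussian_fourth_moment[OF M gY Y0]
    by (simp add: power2_eq_square algebra_simps)
  finally show "(\<integral>\<omega>. (X \<omega>)\<^sup>2 * (Y \<omega>)\<^sup>2 \<partial>M) = ?VX * ?VY + 2 * ?C\<^sup>2" .
qed

text \<open>Cauchy-Schwarz, from the nonnegative quadratic form \<open>(p, q) \<mapsto> \<integral> (pX + qY)\<^sup>2\<close>.\<close>

lemma square_integral_mult_le:
  fixes X Y :: "'a \<Rightarrow> real"
  assumes iX: "integrable M (\<lambda>\<omega>. (X \<omega>)\<^sup>2)" and iY: "integrable M (\<lambda>\<omega>. (Y \<omega>)\<^sup>2)"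
    and iXY: "integrable M (\<lambda>\<omega>. X \<omega> * Y \<omega>)"
  shows "(\<integral>\<omega>. X \<omega> * Y \<omega> \<partial>M)\<^sup>2 \<le> (\<integral>\<omega>. (X \<omega>)\<^sup>2 \<partial>M) * (\<integral>\<omega>. (Y \<omega>)\<^sup>2 \<partial>M)"
    (is "?C\<^sup>2 \<le> ?V * ?W")
proof -
  have quad: "0 \<le> p\<^sup>2 * ?V + 2 * p * q * ?C + q\<^sup>2 * ?W" for p q
  proof -
    have "0 \<le> (\<integral>\<omega>. (p * X \<omega> + q * Y \<omega>)\<^sup>2 \<partial>M)" by simp
    also have "\<dots> = (\<integral>\<omega>. p\<^sup>2 * (X \<omega>)\<^sup>2 + 2 * p * q * (X \<omega> * Y \<omega>) + q\<^sup>2 * (Y \<omega>)\<^sup>2 \<partial>M)"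
      by (intro Bochner_Integration.integral_cong) (auto simp: power2_eq_square algebra_simps)
    also have "\<dots> = p\<^sup>2 * ?V + 2 * p * q * ?C + q\<^sup>2 * ?W"
      using iX iY iXY by simp
    finally show ?thesis .
  qed
  have W0: "0 \<le> ?W" by simp
  show ?thesis
  proof (cases "?W = 0")
    case True
    have "?C = 0"
    proof (rule ccontr)
      assume "?C \<noteq> 0"
      \<comment> \<open>With this choice the form has the value \<open>-1\<close>.\<close>
      then show False using quad[of 1 "- (?V + 1) / (2 * ?C)"] True by (simp add: field_simps)
    qed
    then show ?thesis using True by simp
  next
    case False
    have "0 \<le> ?W * (?V * ?W - ?C\<^sup>2)"
      using quad[of ?W "- ?C"] by (simp add: power2_eq_square algebra_simps)
    then show ?thesis using False W0 by (simp add: zero_le_mult_iff)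
  qed
qed

section \<open>Variance of weighted quadratic functionals\<close>

text \<open>
  Freezing time at the grid point \<open>\<lfloor>nt\<rfloor>/n\<close> gives processes that take only countably many time
  values, hence are jointly measurable; by continuity they converge to \<open>X\<close>.
\<close>

lemma borel_measurable_continuous_paths:
  fixes X :: "real \<Rightarrow> 'a \<Rightarrow> real"
  assumes meas: "\<And>t. X t \<in> borel_measurable M"
    and cont: "\<And>\<omega>. \<omega> \<in> space M \<Longrightarrow> continuous_on UNIV (\<lambda>t. X t \<omega>)"
  shows "(\<lambda>(t, \<omega>). X t \<omega>) \<in> borel_measurable (borel \<Otimes>\<^sub>M M)"
proof (rule borel_measurable_LIMSEQ_real)
  let ?d = "\<lambda>(n::nat) (t::real). of_int \<lfloor>real (Suc n) * t\<rfloor> / real (Suc n)"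
  show "(\<lambda>x. X (?d n (fst x)) (snd x)) \<in> borel_measurable (borel \<Otimes>\<^sub>M M)" for n
    by (rule measurable_compose_countable[where g="\<lambda>x. \<lfloor>real (Suc n) * fst x\<rfloor>"
          and f="\<lambda>i x. X (of_int i / real (Suc n)) (snd x)"])
      (auto intro!: measurable_compose[OF measurable_snd meas])
  fix x assume "x \<in> space (borel \<Otimes>\<^sub>M M :: (real \<times> 'a) measure)"
  then have "snd x \<in> space M" by (auto simp: space_pair_measure)
  then have iso: "isCont (\<lambda>t. X t (snd x)) (fst x)"
    using cont by (auto simp: continuous_on_eq_continuous_at)
  have "(\<lambda>n. ?d n (fst x)) \<longlonglongrightarrow> fst x"
  proof (rule real_tendsto_sandwich)
    show "(\<lambda>n. fst x - 1 / real (Suc n)) \<longlonglongrightarrow> fst x"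
      using tendsto_diff[OF tendsto_const LIMSEQ_inverse_real_of_nat, of "fst x"]
      by (simp add: inverse_eq_divide)
    show "\<forall>\<^sub>F n in sequentially. fst x - 1 / real (Suc n) \<le> ?d n (fst x)"
    proof (rule always_eventually, rule allI)
      fix n
      have "real (Suc n) * fst x - 1 \<le> of_int \<lfloor>real (Suc n) * fst x\<rfloor>" by linarith
      then have "(real (Suc n) * fst x - 1) / real (Suc n) \<le> ?d n (fst x)"
        by (rule divide_right_mono) simp
      then show "fst x - 1 / real (Suc n) \<le> ?d n (fst x)" by (simp add: diff_divide_distrib)
    qed
    show "\<forall>\<^sub>F n in sequentially. ?d n (fst x) \<le> fst x"
    proof (rule always_eventually, rule allI)
      fix n
      have "of_int \<lfloor>real (Suc n) * fst x\<rfloor> \<le> real (Suc n) * fst x" by linarith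
      then have "?d n (fst x) \<le> (real (Suc n) * fst x) / real (Suc n)"
        by (rule divide_right_mono) simp
      then show "?d n (fst x) \<le> fst x" by simp
    qed
  qed auto
  from isCont_tendsto_compose[OF iso this]
  show "(\<lambda>n. X (?d n (fst x)) (snd x)) \<longlonglongrightarrow> (case x of (t, \<omega>) \<Rightarrow> X t \<omega>)"
    by (simp add: case_prod_beta)
qed

lemma integrable_product_kernel:
  fixes f g :: "real \<Rightarrow> real"
  assumes f: "integrable lborel f" and g: "integrable lborel g"
  shows "integrable (lborel \<Otimes>\<^sub>M lborel) (\<lambda>(s, r). f s * g r)"
    and "(\<integral>(s, r). f s * g r \<partial>(lborel \<Otimes>\<^sub>M lborel)) = (\<integral>s. f s \<partial>lborel) * (\<integral>r. g r \<partial>lborel)"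
proof -
  have [measurable]: "f \<in> borel_measurable borel" "g \<in> borel_measurable borel" using f g by auto
  show i: "integrable (lborel \<Otimes>\<^sub>M lborel) (\<lambda>(s, r). f s * g r)"
    by (rule lborel_pair.Fubini_integrable) (use f g in \<open>auto simp: abs_mult\<close>)
  show "(\<integral>(s, r). f s * g r \<partial>(lborel \<Otimes>\<^sub>M lborel)) = (\<integral>s. f s \<partial>lborel) * (\<integral>r. g r \<partial>lborel)"
    using lborel_pair.integral_fst'[OF i] by simp
qed

text \<open>
  The hypothesis on \<open>(X\<^sub>s)\<^sup>2(X\<^sub>r)\<^sup>2\<close> is the conclusion of \<open>isserlis_squares\<close>. The square of \<open>Q\<close> is an
  integral over pairs \<open>(s, r)\<close>; after exchanging it with the expectation, the part \<open>V\<^sub>s V\<^sub>r\<close>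
  integrates to the squared mean, which leaves the covariances in the variance. Integrability of
  \<open>p\<sqdot>V\<close> suffices for all exchanges, since \<open>(C\<^sub>s\<^sub>r)\<^sup>2 \<le> V\<^sub>s V\<^sub>r\<close>.
\<close>

lemma weighted_quadratic_functional_moments:
  fixes X :: "real \<Rightarrow> 'a \<Rightarrow> real" and p V :: "real \<Rightarrow> real" and C :: "real \<Rightarrow> real \<Rightarrow> real"
  assumes "prob_space M"
    and X[measurable]: "(\<lambda>(s, \<omega>). X s \<omega>) \<in> borel_measurable (borel \<Otimes>\<^sub>M M)"
    and p[measurable]: "p \<in> borel_measurable borel" and p0: "\<And>s. 0 \<le> p s"
    and V: "\<And>s. (\<integral>\<omega>. (X s \<omega>)\<^sup>2 \<partial>M) = V s" and iX: "\<And>s. integrable M (\<lambda>\<omega>. (X s \<omega>)\<^sup>2)"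
    and C: "\<And>s r. (\<integral>\<omega>. X s \<omega> * X r \<omega> \<partial>M) = C s r"
    and iXr: "\<And>s r. integrable M (\<lambda>\<omega>. X s \<omega> * X r \<omega>)"
    and iXX: "\<And>s r. integrable M (\<lambda>\<omega>. (X s \<omega>)\<^sup>2 * (X r \<omega>)\<^sup>2)"
    and I: "\<And>s r. (\<integral>\<omega>. (X s \<omega>)\<^sup>2 * (X r \<omega>)\<^sup>2 \<partial>M) = V s * V r + 2 * (C s r)\<^sup>2"
    and pV: "integrable lborel (\<lambda>s. p s * V s)"
  defines "Q \<equiv> \<lambda>\<omega>. \<integral>s. p s * (X s \<omega>)\<^sup>2 \<partial>lborel"
  shows "integrable M (\<lambda>\<omega>. (Q \<omega>)\<^sup>2)"
    and "(\<integral>\<omega>. Q \<omega> \<partial>M) = (\<integral>s. p s * V s \<partial>lborel)"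
    and "(\<integral>\<omega>. (Q \<omega> - (\<integral>\<omega>. Q \<omega> \<partial>M))\<^sup>2 \<partial>M) =
      (\<integral>(s, r). 2 * (p s * p r * (C s r)\<^sup>2) \<partial>(lborel \<Otimes>\<^sub>M lborel))"
    and "integrable (lborel \<Otimes>\<^sub>M lborel) (\<lambda>(s, r). p s * p r * (C s r)\<^sup>2)"
proof -
  interpret prob_space M by fact
  interpret LM: pair_sigma_finite lborel M ..
  let ?P = "lborel \<Otimes>\<^sub>M lborel :: (real \<times> real) measure"
  interpret P: pair_sigma_finite ?P M ..
  have V0: "0 \<le> V s" for s unfolding V[symmetric] by simp
  have [measurable]: "V \<in> borel_measurable borel" unfolding V[symmetric] by measurable
  have C_meas[measurable]: "(\<lambda>(s, r). C s r) \<in> borel_measurable (borel \<Otimes>\<^sub>M borel)"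
    unfolding C[symmetric] by measurable
  have CS: "(C s r)\<^sup>2 \<le> V s * V r" for s r
    unfolding V[symmetric] C[symmetric]
    by (rule square_integral_mult_le[OF iX iX iXr])
  let ?F = "\<lambda>(s, \<omega>). p s * (X s \<omega>)\<^sup>2"
  have iF: "integrable (lborel \<Otimes>\<^sub>M M) ?F"
    by (rule LM.Fubini_integrable) (use pV iX p0 V in \<open>auto\<close>)
  have iQ: "integrable M Q" and aeQ: "AE \<omega> in M. integrable lborel (\<lambda>s. p s * (X s \<omega>)\<^sup>2)"
    unfolding Q_def using LM.integrable_snd[OF iF] LM.AE_integrable_snd[OF iF] by auto
  show EQ: "(\<integral>\<omega>. Q \<omega> \<partial>M) = (\<integral>s. p s * V s \<partial>lborel)"
    unfolding Q_def using LM.Fubini_integral[OF iF] by (simp add: V)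
  note pVpV = integrable_product_kernel[OF pV pV]
  show iC: "integrable ?P (\<lambda>(s, r). p s * p r * (C s r)\<^sup>2)"
  proof (rule Bochner_Integration.integrable_bound[OF pVpV(1)])
    show "AE x in ?P. norm (case x of (s, r) \<Rightarrow> p s * p r * (C s r)\<^sup>2) \<le> norm (case x of (s, r) \<Rightarrow> p s * V s * (p r * V r))"
    proof (rule AE_I2, clarsimp)
      fix s r
      have "p s * p r * (C s r)\<^sup>2 \<le> p s * p r * (V s * V r)"
        using CS p0 by (intro mult_left_mono) auto
      then show "\<bar>p s * p r * (C s r)\<^sup>2\<bar> \<le> \<bar>p s * V s * (p r * V r)\<bar>"
        using p0 V0 by (simp add: abs_mult mult_ac)
    qed
  qed measurable
  let ?G = "\<lambda>((s, r), \<omega>). p s * p r * ((X s \<omega>)\<^sup>2 * (X r \<omega>)\<^sup>2)"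
  have VVC: "integrable ?P (\<lambda>(s, r). p s * V s * (p r * V r) + 2 * (p s * p r * (C s r)\<^sup>2))"
    using Bochner_Integration.integrable_add[OF pVpV(1) integrable_mult_right[OF iC, of 2]]
    by (simp add: case_prod_beta')
  have iG: "integrable (?P \<Otimes>\<^sub>M M) ?G"
  proof (rule P.Fubini_integrable)
    show "integrable ?P (\<lambda>x. \<integral>\<omega>. norm (?G (x, \<omega>)) \<partial>M)"
    proof (rule iffD1[OF Bochner_Integration.integrable_cong VVC])
      show "(case x of (s, r) \<Rightarrow> p s * V s * (p r * V r) + 2 * (p s * p r * (C s r)\<^sup>2)) =
          (\<integral>\<omega>. norm (?G (x, \<omega>)) \<partial>M)" for x
        by (cases x) (simp add: I p0 algebra_simps)
    qed simp
    show "?G \<in> borel_measurable (?P \<Otimes>\<^sub>M M)" unfolding split_beta' by measurable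
  qed (use iXX in \<open>auto\<close>)
  have Q2: "AE \<omega> in M. (Q \<omega>)\<^sup>2 = (\<integral>x. ?G (x, \<omega>) \<partial>?P)"
    using aeQ
  proof eventually_elim
    case (elim \<omega>)
    then show ?case
      unfolding Q_def power2_eq_square[of "\<integral>s. _ s \<partial>lborel"]
        integrable_product_kernel(2)[OF elim elim, symmetric]
      by (intro Bochner_Integration.integral_cong) (auto simp: mult_ac)
  qed
  have iG': "integrable M (\<lambda>\<omega>. \<integral>x. ?G (x, \<omega>) \<partial>?P)"
    using P.integrable_snd[of "\<lambda>x \<omega>. ?G (x, \<omega>)"] iG by (simp add: split_beta')
  have Qm: "Q \<in> borel_measurable M" using iQ by auto
  show iQ2: "integrable M (\<lambda>\<omega>. (Q \<omega>)\<^sup>2)"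
  proof (rule integrable_cong_AE_imp[OF iG'])
    show "AE \<omega> in M. (\<integral>x. ?G (x, \<omega>) \<partial>?P) = (Q \<omega>)\<^sup>2"
      using Q2 by eventually_elim simp
  qed (use Qm in measurable)
  have "(\<integral>\<omega>. (Q \<omega>)\<^sup>2 \<partial>M) = (\<integral>\<omega>. (\<integral>x. ?G (x, \<omega>) \<partial>?P) \<partial>M)"
    using Q2 Qm iG' by (intro integral_cong_AE) auto
  also have "\<dots> = (\<integral>x. (\<integral>\<omega>. ?G (x, \<omega>) \<partial>M) \<partial>?P)"
    using P.Fubini_integral[of "\<lambda>x \<omega>. ?G (x, \<omega>)"] iG by (simp add: split_beta')
  also have "\<dots> = (\<integral>x. (case x of (s, r) \<Rightarrow> p s * V s * (p r * V r)) + (case x of (s, r) \<Rightarrow> 2 * (p s * p r * (C s r)\<^sup>2)) \<partial>?P)"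
    by (intro Bochner_Integration.integral_cong) (auto simp: I algebra_simps)
  also have "\<dots> = (\<integral>\<omega>. Q \<omega> \<partial>M)\<^sup>2 + (\<integral>(s, r). 2 * (p s * p r * (C s r)\<^sup>2) \<partial>?P)"
    using integrable_mult_right[OF iC, of 2] pVpV
    by (subst Bochner_Integration.integral_add) (auto simp: EQ power2_eq_square split_beta')
  finally show "(\<integral>\<omega>. (Q \<omega> - (\<integral>\<omega>. Q \<omega> \<partial>M))\<^sup>2 \<partial>M) = (\<integral>(s, r). 2 * (p s * p r * (C s r)\<^sup>2) \<partial>?P)"
    using variance_eq[OF iQ iQ2] by simp
qed

section \<open>Uniform convergence in probability of monotone processes\<close>

lemma uniform_grid_bracket:
  fixes T :: real
  assumes "0 \<le> T" "0 < n" "t \<in> {0..T}"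
  obtains i j where "i \<le> n" "j \<le> n" "T * real i / n \<le> t" "t \<le> T * real j / n"
    "T * real j / n - T * real i / n \<le> T / n"
proof -
  define j where "j = (LEAST j. t \<le> T * real j / n)"
  have n: "t \<le> T * real n / n" using assms by simp
  have j: "t \<le> T * real j / n" unfolding j_def by (rule LeastI, rule n)
  have jn: "j \<le> n" unfolding j_def by (rule Least_le, rule n)
  show thesis
  proof (cases j)
    case 0
    then show ?thesis using that[of 0 0] j assms by auto
  next
    case (Suc i)
    then have "\<not> t \<le> T * real i / n"
      unfolding j_def using not_less_Least[of i "\<lambda>j. t \<le> T * real j / n"] by simp
    moreover have "T * real j / n - T * real i / n = T / n"
      unfolding Suc by (simp add: algebra_simps add_divide_distrib)
    ultimately show ?thesis using that[of i j] j jn Suc by auto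
  qed
qed

text \<open>
  A deviation larger than \<open>\<delta>\<close> at some time in \<open>[0, T]\<close> forces, by monotonicity of \<open>Y\<close>, a deviation
  larger than \<open>\<delta>/2\<close> at one of the two neighbouring points of any grid on which \<open>L\<close> oscillates by
  less than \<open>\<delta>/2\<close>; finitely many probabilities remain. Continuity of the paths reduces the
  uncountable union over times to a countable dense set, which makes the event measurable.
\<close>

lemma ucp_limit_of_mono:
  assumes "prob_space M"
    and meas: "\<And>\<epsilon> t. 0 < \<epsilon> \<Longrightarrow> 0 \<le> t \<Longrightarrow> Y \<epsilon> t \<in> borel_measurable M"
    and cont: "\<And>\<epsilon> \<omega> T. 0 < \<epsilon> \<Longrightarrow> \<omega> \<in> space M \<Longrightarrow> continuous_on {0..T} (\<lambda>t. Y \<epsilon> t \<omega>)"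
    and mono: "\<And>\<epsilon> \<omega> s t. 0 < \<epsilon> \<Longrightarrow> \<omega> \<in> space M \<Longrightarrow> 0 \<le> s \<Longrightarrow> s \<le> t \<Longrightarrow> Y \<epsilon> s \<omega> \<le> Y \<epsilon> t \<omega>"
    and L: "\<And>T. continuous_on {0..T} L"
    and lim: "\<And>t \<delta>. 0 \<le> t \<Longrightarrow> 0 < \<delta> \<Longrightarrow>
      ((\<lambda>\<epsilon>. measure M {\<omega> \<in> space M. \<bar>Y \<epsilon> t \<omega> - L t\<bar> > \<delta>}) \<longlongrightarrow> 0) (at_right 0)"
  shows "ucp_limit M Y (\<lambda>t \<omega>. L t)"
  unfolding ucp_limit_def
proof (intro allI impI conjI)
  interpret prob_space M by fact
  fix T \<delta> :: real assume T: "0 \<le> T" and \<delta>: "0 < \<delta>"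
  let ?E = "\<lambda>\<epsilon>. {\<omega> \<in> space M. \<exists>t\<in>{0..T}. \<bar>Y \<epsilon> t \<omega> - L t\<bar> > \<delta>}"
  have pos: "eventually (\<lambda>\<epsilon>::real. 0 < \<epsilon>) (at_right 0)"
    by (simp add: eventually_at_right_less)
  have sets: "?E \<epsilon> \<in> sets M" if "0 < \<epsilon>" for \<epsilon>
  proof -
    obtain D where D: "countable D" "D \<subseteq> {0..T}" "{0..T} \<subseteq> closure D"
      using separable[of "{0..T}"] by blast
    have "?E \<epsilon> = (\<Union>t\<in>D. {\<omega> \<in> space M. \<bar>Y \<epsilon> t \<omega> - L t\<bar> > \<delta>})"
    proof (intro set_eqI iffI)
      fix \<omega> assume "\<omega> \<in> ?E \<epsilon>"
      then obtain t where \<omega>: "\<omega> \<in> space M" and t: "t \<in> {0..T}" "\<bar>Y \<epsilon> t \<omega> - L t\<bar> > \<delta>" by auto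
      obtain d where d: "\<And>n. d n \<in> D" "d \<longlonglongrightarrow> t"
        using subsetD[OF D(3) t(1)] unfolding closure_sequential by blast
      have "continuous_on {0..T} (\<lambda>t. \<bar>Y \<epsilon> t \<omega> - L t\<bar>)"
        using cont[OF that \<omega>] L by (intro continuous_intros)
      then have "(\<lambda>n. \<bar>Y \<epsilon> (d n) \<omega> - L (d n)\<bar>) \<longlonglongrightarrow> \<bar>Y \<epsilon> t \<omega> - L t\<bar>"
      proof (rule continuous_on_tendsto_compose[OF _ d(2)])
        have "d m \<in> {0..T}" for m using d(1)[of m] D(2) by auto
        then show "\<forall>\<^sub>F m in sequentially. d m \<in> {0..T}" by simp
      qed (use t(1) in auto)
      from eventually_happens'[OF sequentially_bot order_tendstoD(1)[OF this t(2)]]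
      obtain n where "\<bar>Y \<epsilon> (d n) \<omega> - L (d n)\<bar> > \<delta>" by blast
      then show "\<omega> \<in> (\<Union>t\<in>D. {\<omega> \<in> space M. \<bar>Y \<epsilon> t \<omega> - L t\<bar> > \<delta>})" using d(1) \<omega> by auto
    qed (use D(2) in auto)
    also have "\<dots> \<in> sets M"
    proof (intro sets.countable_UN'' D(1))
      fix t assume "t \<in> D"
      then have [measurable]: "Y \<epsilon> t \<in> borel_measurable M" using D(2) meas[OF that] by auto
      show "{\<omega> \<in> space M. \<bar>Y \<epsilon> t \<omega> - L t\<bar> > \<delta>} \<in> sets M" by measurable
    qed
    finally show ?thesis .
  qed
  show "\<forall>\<^sub>F \<epsilon> in at_right 0. ?E \<epsilon> \<in> sets M"
    using pos by eventually_elim (rule sets)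
  have "uniformly_continuous_on {0..T} L"
    by (intro compact_uniformly_continuous L) auto
  from this[unfolded uniformly_continuous_on_def, rule_format, OF half_gt_zero[OF \<delta>]]
  obtain d where d: "d > 0" "\<And>s t. s \<in> {0..T} \<Longrightarrow> t \<in> {0..T} \<Longrightarrow> \<bar>t - s\<bar> < d \<Longrightarrow> \<bar>L t - L s\<bar> < \<delta> / 2"
    unfolding dist_real_def by blast
  obtain n :: nat where n: "T / d < n" using reals_Archimedean2 by blast
  have "0 \<le> T / d" using T d(1) by simp
  then have n0: "0 < n" using n by (cases n) auto
  have nd: "T / n < d" using n n0 d(1) by (simp add: field_simps)
  let ?g = "\<lambda>i. T * real i / n"
  have g: "?g i \<in> {0..T}" if "i \<le> n" for i
    using that T n0 by (simp add: pos_divide_le_eq mult_left_mono)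
  let ?F = "\<lambda>\<epsilon> i. {\<omega> \<in> space M. \<bar>Y \<epsilon> (?g i) \<omega> - L (?g i)\<bar> > \<delta> / 2}"
  have bound: "measure M (?E \<epsilon>) \<le> (\<Sum>i\<le>n. measure M (?F \<epsilon> i))" if "0 < \<epsilon>" for \<epsilon>
  proof -
    have F: "?F \<epsilon> i \<in> sets M" if i: "i \<in> {..n}" for i
    proof -
      have [measurable]: "Y \<epsilon> (?g i) \<in> borel_measurable M" using g[of i] i meas[OF \<open>0 < \<epsilon>\<close>] by auto
      show ?thesis by measurable
    qed
    have "?E \<epsilon> \<subseteq> (\<Union>i\<le>n. ?F \<epsilon> i)"
    proof
      fix \<omega> assume "\<omega> \<in> ?E \<epsilon>"
      then obtain t where \<omega>: "\<omega> \<in> space M" and t: "t \<in> {0..T}" "\<bar>Y \<epsilon> t \<omega> - L t\<bar> > \<delta>" by auto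
      obtain i j where ij: "i \<le> n" "j \<le> n" "?g i \<le> t" "t \<le> ?g j" "?g j - ?g i \<le> T / n"
        by (rule uniform_grid_bracket[OF T n0 t(1)])
      have "Y \<epsilon> (?g i) \<omega> \<le> Y \<epsilon> t \<omega>" "Y \<epsilon> t \<omega> \<le> Y \<epsilon> (?g j) \<omega>"
        using mono[OF that \<omega> _ ij(3)] mono[OF that \<omega> _ ij(4)] g[OF ij(1)] t(1)
        unfolding atLeastAtMost_iff by blast+
      moreover have "\<bar>t - ?g i\<bar> < d" "\<bar>t - ?g j\<bar> < d"
        using ij(3-5) nd by linarith+
      then have "\<bar>L t - L (?g i)\<bar> < \<delta> / 2" "\<bar>L t - L (?g j)\<bar> < \<delta> / 2"
        using d(2)[OF g[OF ij(1)] t(1)] d(2)[OF g[OF ij(2)] t(1)] by blast+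
      ultimately have "\<bar>Y \<epsilon> (?g i) \<omega> - L (?g i)\<bar> > \<delta> / 2 \<or> \<bar>Y \<epsilon> (?g j) \<omega> - L (?g j)\<bar> > \<delta> / 2"
        using t(2) by linarith
      then show "\<omega> \<in> (\<Union>i\<le>n. ?F \<epsilon> i)" using \<omega> ij(1,2) by blast
    qed
    then have "measure M (?E \<epsilon>) \<le> measure M (\<Union>i\<le>n. ?F \<epsilon> i)"
      using F by (intro finite_measure_mono) auto
    also have "\<dots> \<le> (\<Sum>i\<le>n. measure M (?F \<epsilon> i))"
      using F by (intro finite_measure_subadditive_finite) auto
    finally show ?thesis .
  qed
  have "((\<lambda>\<epsilon>. \<Sum>i\<le>n. measure M (?F \<epsilon> i)) \<longlongrightarrow> (\<Sum>i\<le>n. 0)) (at_right 0)"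
    using g \<delta> by (intro tendsto_sum lim) auto
  then have S: "((\<lambda>\<epsilon>. \<Sum>i\<le>n. measure M (?F \<epsilon> i)) \<longlongrightarrow> 0) (at_right 0)" by simp
  show "((\<lambda>\<epsilon>. measure M (?E \<epsilon>)) \<longlongrightarrow> 0) (at_right 0)"
  proof (rule tendsto_sandwich[OF _ _ tendsto_const S])
    show "\<forall>\<^sub>F \<epsilon> in at_right 0. measure M (?E \<epsilon>) \<le> (\<Sum>i\<le>n. measure M (?F \<epsilon> i))"
      using pos by eventually_elim (rule bound)
  qed simp
qed

section \<open>Incomplete Beta-type integrals\<close>

text \<open>
  The closed forms for Beta and power integrals are stated for the gauge integral; nonnegativity
  transfers them to the Lebesgue integral.
\<close>

lemma has_bochner_integral_of_nonneg:
  fixes f :: "real \<Rightarrow> real"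
  assumes [measurable]: "f \<in> borel_measurable borel" "S \<in> sets borel"
    and f0: "\<And>x. x \<in> S \<Longrightarrow> 0 \<le> f x" and f: "(f has_integral y) S"
  shows "has_bochner_integral lborel (\<lambda>x. indicator S x * f x) y"
proof -
  have "f absolutely_integrable_on S"
    using f f0 by (intro nonnegative_absolutely_integrable_1) auto
  then have i: "set_integrable lborel S f"
    unfolding set_integrable_def by (subst (asm) integrable_completion) auto
  show ?thesis
    using i set_borel_integral_eq_integral(2)[OF i] integral_unique[OF f]
    by (simp add: has_bochner_integral_iff set_integrable_def set_lebesgue_integral_def)
qed

text \<open>
  The covariance of the process at times \<open>s \<le> t\<close> is a multiple of
  \<open>\<integral>\<^bsub>0\<^esub>\<^bsup>s\<^esup> wkernel t u + wkernel s u du\<close>.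
\<close>

definition wkernel :: "real \<Rightarrow> real \<Rightarrow> real \<Rightarrow> real \<Rightarrow> real" where
  "wkernel a b x u = u powr a * (x - u) powr b"

lemma wkernel_measurable[measurable]: "wkernel a b x \<in> borel_measurable borel"
  unfolding wkernel_def by measurable

text \<open>On \<open>[0, x]\<close> the substitution \<open>u = xv\<close> turns the kernel into the Beta integrand.\<close>

lemma wkernel_integrable:
  assumes a: "a > -1" and b: "b > -1" and pq: "0 \<le> p" "q \<le> x"
  shows "set_integrable lborel {p..q} (wkernel a b x)"
proof (cases "p \<le> q")
  case False
  then show ?thesis by (simp add: set_integrable_def)
next
  case True
  then have "0 \<le> x" using pq by simp
  have "set_integrable lborel {0..x} (wkernel a b x)"
  proof (cases "x = 0")
    case True
    have "AE u in lborel. indicator {0..x} u *\<^sub>R wkernel a b x u = 0"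
      using AE_lborel_singleton[of 0] by eventually_elim (simp add: True wkernel_def)
    then show ?thesis
      unfolding set_integrable_def
      by (subst integrable_cong_AE[where g="\<lambda>_. 0"]) auto
  next
    case False
    then have x: "0 < x" using \<open>0 \<le> x\<close> by simp
    have "has_bochner_integral lborel (\<lambda>v. indicator {0..1} v * (v powr a * (1 - v) powr b)) (Beta (a + 1) (b + 1))"
      using has_integral_Beta_real[of "a + 1" "b + 1"] a b
      by (intro has_bochner_integral_of_nonneg) auto
    then have "integrable lborel (\<lambda>v. indicator {0..1} v * (v powr a * (1 - v) powr b))"
      by (rule integrable.intros)
    from lborel_integrable_real_affine[OF this, of "1 / x" 0]
    have "integrable lborel (\<lambda>u. x powr (a + b) * (indicator {0..1} (u / x) * ((u / x) powr a * (1 - u / x) powr b)))"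
      using x by (intro integrable_mult_right) simp
    also have "(\<lambda>u. x powr (a + b) * (indicator {0..1} (u / x) * ((u / x) powr a * (1 - u / x) powr b)))
        = (\<lambda>u. indicator {0..x} u *\<^sub>R wkernel a b x u)"
    proof
      fix u
      show "x powr (a + b) * (indicator {0..1} (u / x) * ((u / x) powr a * (1 - u / x) powr b))
        = indicator {0..x} u *\<^sub>R wkernel a b x u"
      proof (cases "u \<in> {0..x}")
        case True
        have "1 - u / x = (x - u) / x" using x by (simp add: field_simps)
        then show ?thesis
          using True x by (simp add: wkernel_def powr_divide powr_add)
      next
        case False
        then show ?thesis using x by (auto simp: indicator_def zero_le_divide_iff)
      qed
    qed
    finally show ?thesis by (simp add: set_integrable_def)
  qed
  then show ?thesis
    by (rule set_integrable_subset) (use pq in auto)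
qed

definition wint :: "real \<Rightarrow> real \<Rightarrow> real \<Rightarrow> real \<Rightarrow> real \<Rightarrow> real" where
  "wint a b p q x = (LBINT u:{p..q}. wkernel a b x u)"

lemma wint_has_integral:
  assumes "a > -1" "b > -1" "0 \<le> p" "q \<le> x"
  shows "(wkernel a b x has_integral wint a b p q x) {p..q}"
  using set_borel_integral_eq_integral[OF wkernel_integrable[OF assms]]
  by (simp add: wint_def has_integral_integral)

lemma wint_combine:
  assumes "a > -1" "b > -1" "0 \<le> p" "p \<le> q" "q \<le> r" "r \<le> x"
  shows "wint a b p r x = wint a b p q x + wint a b q r x"
proof -
  have "(wkernel a b x has_integral wint a b p q x) {p..q}"
    "(wkernel a b x has_integral wint a b q r x) {q..r}"
    "(wkernel a b x has_integral wint a b p r x) {p..r}"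
    using assms by (intro wint_has_integral; simp)+
  then show ?thesis
    using has_integral_combine[OF assms(4,5)] has_integral_unique by blast
qed

lemma has_integral_reflected_power:
  fixes b x \<epsilon> :: real
  assumes "b > -1" "0 \<le> \<epsilon>"
  shows "((\<lambda>u. (x - u) powr b) has_integral \<epsilon> powr (b + 1) / (b + 1)) {x - \<epsilon>..x}"
proof -
  have "has_bochner_integral lborel (\<lambda>v. indicator {0..\<epsilon>} v * v powr b) (\<epsilon> powr (b + 1) / (b + 1))"
    using has_integral_powr_from_0[OF assms]
    by (intro has_bochner_integral_of_nonneg) auto
  then have "has_bochner_integral lborel (\<lambda>u. indicator {0..\<epsilon>} (x - u) * (x - u) powr b) (\<epsilon> powr (b + 1) / (b + 1))"
    using lborel_has_bochner_integral_real_affine_iff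
      [of "-1" "\<lambda>v. indicator {0..\<epsilon>} v * v powr b" "\<epsilon> powr (b + 1) / (b + 1)" x]
    by simp
  also have "(\<lambda>u. indicator {0..\<epsilon>} (x - u) * (x - u) powr b) = (\<lambda>u. indicator {x - \<epsilon>..x} u *\<^sub>R (x - u) powr b)"
    by (auto simp: indicator_def fun_eq_iff)
  finally have "set_integrable lborel {x - \<epsilon>..x} (\<lambda>u. (x - u) powr b)"
    "(LBINT u:{x - \<epsilon>..x}. (x - u) powr b) = \<epsilon> powr (b + 1) / (b + 1)"
    by (auto simp: has_bochner_integral_iff set_integrable_def set_lebesgue_integral_def)
  then show ?thesis
    using set_borel_integral_eq_integral by (metis has_integral_integral)
qed

lemma powr_between:
  fixes a s u t :: real
  assumes "0 < s" "s \<le> u" "u \<le> t"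
  shows "min (s powr a) (t powr a) \<le> u powr a" "u powr a \<le> max (s powr a) (t powr a)"
proof -
  have "(s powr a \<le> u powr a \<and> u powr a \<le> t powr a) \<or> (t powr a \<le> u powr a \<and> u powr a \<le> s powr a)"
  proof (cases "0 \<le> a")
    case True
    then show ?thesis using assms by (auto intro!: powr_mono2)
  next
    case False
    then show ?thesis using assms by (auto intro!: powr_mono2')
  qed
  then show "min (s powr a) (t powr a) \<le> u powr a" "u powr a \<le> max (s powr a) (t powr a)" by auto
qed

text \<open>Pull the extreme values of \<open>u\<^sup>a\<close> out of the integral; what remains is explicit.\<close>

lemma wint_diagonal_bounds:
  assumes a: "a > -1" and b: "b > -1" and s: "0 < s" and \<epsilon>: "0 < \<epsilon>"
  shows "min (s powr a) ((s + \<epsilon>) powr a) * (\<epsilon> powr (1 + b) / (1 + b)) \<le> wint a b s (s + \<epsilon>) (s + \<epsilon>)"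
    and "wint a b s (s + \<epsilon>) (s + \<epsilon>) \<le> max (s powr a) ((s + \<epsilon>) powr a) * (\<epsilon> powr (1 + b) / (1 + b))"
proof -
  note k = wint_has_integral[OF a b, of s "s + \<epsilon>" "s + \<epsilon>"]
  have p: "((\<lambda>u. c * (s + \<epsilon> - u) powr b) has_integral c * (\<epsilon> powr (1 + b) / (1 + b))) {s..s + \<epsilon>}" for c
    using has_integral_mult_right[OF has_integral_reflected_power[OF b, of \<epsilon> "s + \<epsilon>"], of c] \<epsilon>
    by (simp add: add.commute)
  show "min (s powr a) ((s + \<epsilon>) powr a) * (\<epsilon> powr (1 + b) / (1 + b)) \<le> wint a b s (s + \<epsilon>) (s + \<epsilon>)"
    using s powr_between(1)[OF s, of _ "s + \<epsilon>" a]
    by (intro has_integral_le[OF p k]) (auto simp: wkernel_def intro!: mult_right_mono)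
  show "wint a b s (s + \<epsilon>) (s + \<epsilon>) \<le> max (s powr a) ((s + \<epsilon>) powr a) * (\<epsilon> powr (1 + b) / (1 + b))"
    using s powr_between(2)[OF s, of _ "s + \<epsilon>" a]
    by (intro has_integral_le[OF k p]) (auto simp: wkernel_def intro!: mult_right_mono)
qed

lemma powr_increment_bound:
  fixes b d x \<epsilon> :: real
  assumes b: "b < 1" and d: "0 < d" "d \<le> x" and \<epsilon>: "0 < \<epsilon>"
  shows "\<bar>(x + \<epsilon>) powr b - x powr b\<bar> \<le> \<bar>b\<bar> * d powr (b - 1) * \<epsilon>"
proof -
  have "\<exists>z>x. z < x + \<epsilon> \<and> (x + \<epsilon>) powr b - x powr b = (x + \<epsilon> - x) * (b * z powr (b - 1))"
    using d \<epsilon> by (intro MVT2 has_real_derivative_powr) auto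
  then obtain z where z: "x < z" "(x + \<epsilon>) powr b - x powr b = \<epsilon> * (b * z powr (b - 1))" by auto
  have "z powr (b - 1) \<le> d powr (b - 1)"
    using z(1) d b by (intro powr_mono2') auto
  then have "\<epsilon> * (\<bar>b\<bar> * z powr (b - 1)) \<le> \<epsilon> * (\<bar>b\<bar> * d powr (b - 1))"
    using \<epsilon> by (intro mult_left_mono) auto
  then show ?thesis using z(2) \<epsilon> by (simp add: abs_mult mult_ac)
qed

text \<open>
  At distance at least \<open>d\<close> from the singularity of \<open>(s-u)\<^sup>b\<close> the mean value theorem gains a factor
  \<open>\<epsilon>\<close>, in addition to the length \<open>\<epsilon>\<close> of the interval. The gap \<open>s - r = 2d\<close> leaves room for \<open>u\<close> to
  move by \<open>\<epsilon> \<le> d\<close>.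
\<close>

lemma wint_offdiagonal_bound:
  assumes a: "a > -1" and b: "b > -1" "b < 1" and r: "0 < r" and d: "0 < d" and s: "s = r + 2 * d"
    and \<epsilon>: "0 < \<epsilon>" "\<epsilon> \<le> d" "\<epsilon> \<le> 1"
  shows "\<bar>wint a b r (r + \<epsilon>) (s + \<epsilon>) - wint a b r (r + \<epsilon>) s\<bar>
    \<le> max (r powr a) ((r + 1) powr a) * (\<bar>b\<bar> * d powr (b - 1)) * \<epsilon>\<^sup>2"
proof -
  let ?M = "max (r powr a) ((r + 1) powr a)" and ?D = "\<bar>b\<bar> * d powr (b - 1)"
  let ?i = "wint a b r (r + \<epsilon>) (s + \<epsilon>) - wint a b r (r + \<epsilon>) s"
  have "((\<lambda>u. wkernel a b (s + \<epsilon>) u - wkernel a b s u) has_integral ?i) {r..r + \<epsilon>}"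
    using r d s \<epsilon> by (intro has_integral_diff wint_has_integral a b) auto
  moreover have "norm (wkernel a b (s + \<epsilon>) u - wkernel a b s u) \<le> ?M * (?D * \<epsilon>)"
    if u: "u \<in> {r..r + \<epsilon>}" for u
  proof -
    have "u powr a \<le> ?M"
      using u r \<epsilon> by (intro powr_between) auto
    moreover have "\<bar>(s - u + \<epsilon>) powr b - (s - u) powr b\<bar> \<le> ?D * \<epsilon>"
      using u s \<epsilon> by (intro powr_increment_bound b d) auto
    ultimately have "u powr a * \<bar>(s - u + \<epsilon>) powr b - (s - u) powr b\<bar> \<le> ?M * (?D * \<epsilon>)"
      by (intro mult_mono) (auto simp: le_max_iff_disj)
    moreover have "s - u + \<epsilon> = s + \<epsilon> - u" by simp
    ultimately show ?thesis
      by (simp add: wkernel_def abs_mult flip: right_diff_distrib)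
  qed
  ultimately have "norm ?i \<le> ?M * (?D * \<epsilon>) * measure lborel {r..r + \<epsilon>}"
    using \<epsilon> by (intro has_integral_bound_real[where S="{}"])
      (auto simp: le_max_iff_disj intro!: mult_nonneg_nonneg)
  then show ?thesis using \<epsilon> by (simp add: power2_eq_square mult_ac)
qed

section \<open>Dominated convergence along \<open>\<epsilon> \<down> 0\<close>\<close>

lemma dominated_convergence_at_right_0:
  fixes f :: "real \<Rightarrow> 'a \<Rightarrow> real"
  assumes g: "g \<in> borel_measurable M"
    and f: "\<And>\<epsilon>. 0 < \<epsilon> \<Longrightarrow> \<epsilon> < 1 \<Longrightarrow> f \<epsilon> \<in> borel_measurable M"
    and h: "integrable M h"
    and bound: "\<And>\<epsilon> x. 0 < \<epsilon> \<Longrightarrow> \<epsilon> < 1 \<Longrightarrow> norm (f \<epsilon> x) \<le> h x"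
    and lim: "AE x in M. ((\<lambda>\<epsilon>. f \<epsilon> x) \<longlongrightarrow> g x) (at_right 0)"
  shows "((\<lambda>\<epsilon>. integral\<^sup>L M (f \<epsilon>)) \<longlongrightarrow> integral\<^sup>L M g) (at_right 0)"
proof (rule tendsto_at_right_sequentially[of 0 1])
  fix S :: "nat \<Rightarrow> real"
  assume S: "\<And>n. 0 < S n" "\<And>n. S n < 1" "S \<longlonglongrightarrow> 0"
  have "S n \<noteq> 0" for n using S(1)[of n] by simp
  with S have S': "filterlim S (at_right 0) sequentially"
    by (auto simp: filterlim_at intro!: always_eventually)
  show "(\<lambda>n. integral\<^sup>L M (f (S n))) \<longlonglongrightarrow> integral\<^sup>L M g"
  proof (rule integral_dominated_convergence[OF g _ h])
    show "AE x in M. (\<lambda>n. f (S n) x) \<longlonglongrightarrow> g x"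
      using lim by eventually_elim (rule filterlim_compose[OF _ S'])
  qed (use f S bound in auto)
qed simp

lemma AE_lborel_pair_distinct: "AE x in lborel \<Otimes>\<^sub>M lborel. fst x \<noteq> (snd x :: real)"
proof (rule lborel_pair.AE_pair_measure)
  show "{x \<in> space (lborel \<Otimes>\<^sub>M lborel). fst x \<noteq> (snd x :: real)} \<in> sets (lborel \<Otimes>\<^sub>M lborel)" by measurable
  show "AE x in lborel. AE y in lborel. fst (x, y) \<noteq> (snd (x, y) :: real)"
  proof (rule AE_I2)
    fix x :: real
    show "AE y in lborel. fst (x, y) \<noteq> snd (x, y)"
      using AE_lborel_singleton[of x] by eventually_elim auto
  qed
qed

section \<open>Increments of weighted fractional Brownian motion\<close>

locale weighted_fBm_process = prob_space M
  for M :: "'a measure" +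
  fixes a b :: real and B :: "real \<Rightarrow> 'a \<Rightarrow> real"
  assumes a: "-1 < a" and b: "\<bar>b\<bar> < 1" and ab: "\<bar>b\<bar> < 1 + a"
    and wfBm: "weighted_fBm a b M B"
begin

lemma b1: "-1 < b" and b2: "b < 1" and ab1: "0 < 1 + a + b"
  using b ab by auto

lemma B_linear_gaussian:
  assumes "finite T" "T \<subseteq> {0..}"
  shows "gaussian_rv M (\<lambda>\<omega>. \<Sum>t\<in>T. c t * B t \<omega>)"
  using wfBm assms by (auto simp: weighted_fBm_def gaussian_process_def)

lemma B_continuous: "\<omega> \<in> space M \<Longrightarrow> continuous_on {0..} (\<lambda>t. B t \<omega>)"
  using wfBm by (auto simp: weighted_fBm_def)

lemma B_mean: "0 \<le> t \<Longrightarrow> expectation (B t) = 0"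
  using wfBm by (auto simp: weighted_fBm_def)

text \<open>
  The times may coincide, whereas a Gaussian process is specified through sums over sets of times;
  the coefficients of equal times therefore have to be added up.
\<close>

lemma gaussian_four_times:
  assumes "0 \<le> t1" "0 \<le> t2" "0 \<le> t3" "0 \<le> t4"
  shows "gaussian_rv M (\<lambda>\<omega>. c1 * B t1 \<omega> + c2 * B t2 \<omega> + c3 * B t3 \<omega> + c4 * B t4 \<omega>)"
proof -
  let ?T = "{t1, t2, t3, t4}"
  let ?\<delta> = "\<lambda>x k t. if t = x then k else (0::real)"
  have D: "(\<Sum>t\<in>?T. ?\<delta> x k t * B t \<omega>) = k * B x \<omega>" if "x \<in> ?T" for x k \<omega>
  proof -
    have "(\<Sum>t\<in>?T. ?\<delta> x k t * B t \<omega>) = (\<Sum>t\<in>?T. if t = x then k * B t \<omega> else 0)"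
      by (intro sum.cong) auto
    also have "\<dots> = k * B x \<omega>" using that by (subst sum.delta) auto
    finally show ?thesis .
  qed
  have "gaussian_rv M (\<lambda>\<omega>. \<Sum>t\<in>?T. (?\<delta> t1 c1 t + ?\<delta> t2 c2 t + ?\<delta> t3 c3 t + ?\<delta> t4 c4 t) * B t \<omega>)"
    using assms by (intro B_linear_gaussian) auto
  then show ?thesis
    unfolding distrib_right sum.distrib by (subst (asm) (1 2 3 4) D) auto
qed

lemma B_gaussian: "0 \<le> t \<Longrightarrow> gaussian_rv M (B t)"
  using gaussian_four_times[of t t t t 1 0 0 0] by simp

lemma B_measurable: "0 \<le> t \<Longrightarrow> B t \<in> borel_measurable M"
  using B_gaussian by (simp add: gaussian_rv_def)

lemma B_integrable: "0 \<le> t \<Longrightarrow> integrable M (B t)"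
  using integrable_power_gaussian[OF prob_space_axioms B_gaussian B_mean, of t 1] by simp

lemma B_prod_integrable:
  assumes "0 \<le> s" "0 \<le> t"
  shows "integrable M (\<lambda>\<omega>. B t \<omega> * B s \<omega>)"
  using gaussian_four_times[of t s s s _ _ 0 0] assms
  by (intro isserlis_squares(1)[OF prob_space_axioms] B_mean) auto

lemma B_cov:
  assumes "0 \<le> s" "s \<le> t"
  shows "expectation (\<lambda>\<omega>. B t \<omega> * B s \<omega>) =
    (wint a b 0 s t + wint a b 0 s s) / (2 * Beta (a + 1) (b + 1))"
    and "expectation (\<lambda>\<omega>. B s \<omega> * B t \<omega>) =
    (wint a b 0 s t + wint a b 0 s s) / (2 * Beta (a + 1) (b + 1))"
proof -
  have "0 \<le> t" using assms by simp
  then have "expectation (\<lambda>\<omega>. B t \<omega> * B s \<omega>) = 1 / (2 * Beta (a + 1) (b + 1)) *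
        (LBINT u:{0..min s t}. u powr a * ((t - u) powr b + (s - u) powr b))"
    using wfBm \<open>0 \<le> s\<close> unfolding weighted_fBm_def by (simp add: min.commute)
  also have "(LBINT u:{0..min s t}. u powr a * ((t - u) powr b + (s - u) powr b)) =
      (LBINT u:{0..s}. wkernel a b t u + wkernel a b s u)"
    using assms by (simp add: min_absorb1 wkernel_def distrib_left)
  also have "\<dots> = wint a b 0 s t + wint a b 0 s s"
    unfolding wint_def using assms a b1 by (intro set_integral_add wkernel_integrable) auto
  finally show "expectation (\<lambda>\<omega>. B t \<omega> * B s \<omega>) =
    (wint a b 0 s t + wint a b 0 s s) / (2 * Beta (a + 1) (b + 1))" by simp
  then show "expectation (\<lambda>\<omega>. B s \<omega> * B t \<omega>) =
    (wint a b 0 s t + wint a b 0 s s) / (2 * Beta (a + 1) (b + 1))" by (simp add: mult.commute)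
qed

text \<open>
  Clamping the time at 0 makes the increment a process with continuous paths on the whole line,
  so that the moments below are measurable functions of all real times.
\<close>

definition incr :: "real \<Rightarrow> real \<Rightarrow> 'a \<Rightarrow> real" where
  "incr \<epsilon> s \<omega> = B (max 0 s + \<epsilon>) \<omega> - B (max 0 s) \<omega>"

definition V :: "real \<Rightarrow> real \<Rightarrow> real" where
  "V \<epsilon> s = expectation (\<lambda>\<omega>. (incr \<epsilon> s \<omega>)\<^sup>2)"

definition C :: "real \<Rightarrow> real \<Rightarrow> real \<Rightarrow> real" where
  "C \<epsilon> s r = expectation (\<lambda>\<omega>. incr \<epsilon> s \<omega> * incr \<epsilon> r \<omega>)"

lemma C_commute: "C \<epsilon> s r = C \<epsilon> r s"
  by (simp add: C_def mult.commute)

lemma incr_jointly_measurable: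
  assumes "0 \<le> \<epsilon>"
  shows "(\<lambda>(s, \<omega>). incr \<epsilon> s \<omega>) \<in> borel_measurable (borel \<Otimes>\<^sub>M M)"
proof (rule borel_measurable_continuous_paths)
  show "incr \<epsilon> s \<in> borel_measurable M" for s
    unfolding incr_def[abs_def] using assms by (intro borel_measurable_diff B_measurable) auto
  fix \<omega> assume "\<omega> \<in> space M"
  note c = B_continuous[OF this]
  show "continuous_on UNIV (\<lambda>s. incr \<epsilon> s \<omega>)"
    unfolding incr_def using assms
    by (intro continuous_on_diff continuous_on_compose2[OF c]) (auto intro!: continuous_intros)
qed

lemma incr_moments:
  assumes "0 \<le> \<epsilon>"
  shows "expectation (incr \<epsilon> s) = 0"
    and "gaussian_rv M (\<lambda>\<omega>. p * incr \<epsilon> s \<omega> + q * incr \<epsilon> r \<omega>)"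
proof -
  show "expectation (incr \<epsilon> s) = 0"
    unfolding incr_def[abs_def] using assms by (simp add: B_integrable B_mean)
  show "gaussian_rv M (\<lambda>\<omega>. p * incr \<epsilon> s \<omega> + q * incr \<epsilon> r \<omega>)"
    using gaussian_four_times[of "max 0 s + \<epsilon>" "max 0 s" "max 0 r + \<epsilon>" "max 0 r" p "- p" q "- q"] assms
    by (simp add: incr_def algebra_simps)
qed

lemma incr_isserlis:
  assumes "0 \<le> \<epsilon>"
  shows "integrable M (\<lambda>\<omega>. incr \<epsilon> s \<omega> * incr \<epsilon> r \<omega>)"
    and "integrable M (\<lambda>\<omega>. (incr \<epsilon> s \<omega>)\<^sup>2 * (incr \<epsilon> r \<omega>)\<^sup>2)"
    and "expectation (\<lambda>\<omega>. (incr \<epsilon> s \<omega>)\<^sup>2 * (incr \<epsilon> r \<omega>)\<^sup>2) =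
      expectation (\<lambda>\<omega>. (incr \<epsilon> s \<omega>)\<^sup>2) * expectation (\<lambda>\<omega>. (incr \<epsilon> r \<omega>)\<^sup>2)
        + 2 * (expectation (\<lambda>\<omega>. incr \<epsilon> s \<omega> * incr \<epsilon> r \<omega>))\<^sup>2"
  by (rule isserlis_squares[OF prob_space_axioms] incr_moments assms)+

lemma incr_square_integrable: "0 \<le> \<epsilon> \<Longrightarrow> integrable M (\<lambda>\<omega>. (incr \<epsilon> s \<omega>)\<^sup>2)"
  using incr_isserlis(1)[of \<epsilon> s s] by (simp add: power2_eq_square)

lemma C_square_le: "0 \<le> \<epsilon> \<Longrightarrow> (C \<epsilon> s r)\<^sup>2 \<le> V \<epsilon> s * V \<epsilon> r"
  unfolding C_def V_def
  by (intro square_integral_mult_le incr_square_integrable incr_isserlis(1))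

lemma V_nonneg: "0 \<le> V \<epsilon> s"
  by (simp add: V_def)

text \<open>
  In the second difference of the covariance over disjoint intervals everything that depends on a
  single time cancels, and the integrals over \<open>[0, r]\<close> cancel as well.
\<close>

lemma C_eq_wint:
  assumes "0 \<le> r" "0 \<le> \<epsilon>" "r + \<epsilon> \<le> s"
  shows "C \<epsilon> s r = (wint a b r (r + \<epsilon>) (s + \<epsilon>) - wint a b r (r + \<epsilon>) s) / (2 * Beta (a + 1) (b + 1))"
proof -
  have s: "0 \<le> s" using assms by simp
  have "C \<epsilon> s r = expectation (\<lambda>\<omega>. B (s + \<epsilon>) \<omega> * B (r + \<epsilon>) \<omega> - B (s + \<epsilon>) \<omega> * B r \<omega>
      - B s \<omega> * B (r + \<epsilon>) \<omega> + B s \<omega> * B r \<omega>)"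
    unfolding C_def incr_def using assms(1) s
    by (intro Bochner_Integration.integral_cong) (auto simp: algebra_simps)
  also have "\<dots> = expectation (\<lambda>\<omega>. B (s + \<epsilon>) \<omega> * B (r + \<epsilon>) \<omega>) - expectation (\<lambda>\<omega>. B (s + \<epsilon>) \<omega> * B r \<omega>)
      - expectation (\<lambda>\<omega>. B s \<omega> * B (r + \<epsilon>) \<omega>) + expectation (\<lambda>\<omega>. B s \<omega> * B r \<omega>)"
    using assms s by (simp add: B_prod_integrable)
  also have "\<dots> = ((wint a b 0 (r + \<epsilon>) (s + \<epsilon>) - wint a b 0 r (s + \<epsilon>))
      - (wint a b 0 (r + \<epsilon>) s - wint a b 0 r s)) / (2 * Beta (a + 1) (b + 1))"
    using assms s by (simp add: B_cov flip: diff_divide_distrib add_divide_distrib)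
  also have "\<dots> = (wint a b r (r + \<epsilon>) (s + \<epsilon>) - wint a b r (r + \<epsilon>) s) / (2 * Beta (a + 1) (b + 1))"
    using wint_combine[OF a b1, of 0 r "r + \<epsilon>" "s + \<epsilon>"] wint_combine[OF a b1, of 0 r "r + \<epsilon>" s] assms s
    by simp
  finally show ?thesis .
qed

lemma V_eq_wint:
  assumes "0 \<le> s" "0 \<le> \<epsilon>"
  shows "V \<epsilon> s = wint a b s (s + \<epsilon>) (s + \<epsilon>) / Beta (a + 1) (b + 1)"
proof -
  have "V \<epsilon> s = expectation (\<lambda>\<omega>. B (s + \<epsilon>) \<omega> * B (s + \<epsilon>) \<omega> - 2 * (B (s + \<epsilon>) \<omega> * B s \<omega>) + B s \<omega> * B s \<omega>)"
    unfolding V_def incr_def using assms(1)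
    by (intro Bochner_Integration.integral_cong) (auto simp: algebra_simps power2_eq_square)
  also have "\<dots> = expectation (\<lambda>\<omega>. B (s + \<epsilon>) \<omega> * B (s + \<epsilon>) \<omega>) - 2 * expectation (\<lambda>\<omega>. B (s + \<epsilon>) \<omega> * B s \<omega>)
      + expectation (\<lambda>\<omega>. B s \<omega> * B s \<omega>)"
    using assms by (simp add: B_prod_integrable)
  also have "\<dots> = (wint a b 0 (s + \<epsilon>) (s + \<epsilon>) - wint a b 0 s (s + \<epsilon>)) / Beta (a + 1) (b + 1)"
    using assms by (simp add: B_cov diff_divide_distrib add_divide_distrib)
  also have "\<dots> = wint a b s (s + \<epsilon>) (s + \<epsilon>) / Beta (a + 1) (b + 1)"
    using wint_combine[OF a b1, of 0 s "s + \<epsilon>" "s + \<epsilon>"] assms by simp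
  finally show ?thesis .
qed

lemma Beta_pos: "0 < Beta (a + 1) (b + 1)"
  using a b1 by (simp add: Beta_def Gamma_real_pos)

lemma kappa_pos: "0 < kappa a b"
  using Beta_pos b1 by (simp add: kappa_def)

lemma V_bounds:
  assumes "0 < s" "0 < \<epsilon>"
  shows "kappa a b * min (s powr a) ((s + \<epsilon>) powr a) \<le> V \<epsilon> s / \<epsilon> powr (1 + b)"
    and "V \<epsilon> s / \<epsilon> powr (1 + b) \<le> kappa a b * max (s powr a) ((s + \<epsilon>) powr a)"
proof -
  let ?c = "Beta (a + 1) (b + 1) * \<epsilon> powr (1 + b)"
  have c: "0 \<le> ?c" using Beta_pos by simp
  have V: "V \<epsilon> s / \<epsilon> powr (1 + b) = wint a b s (s + \<epsilon>) (s + \<epsilon>) / ?c"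
    using assms by (simp add: V_eq_wint)
  have k: "x * (\<epsilon> powr (1 + b) / (1 + b)) / ?c = kappa a b * x" for x
    using assms by (simp add: kappa_def)
  show "kappa a b * min (s powr a) ((s + \<epsilon>) powr a) \<le> V \<epsilon> s / \<epsilon> powr (1 + b)"
    and "V \<epsilon> s / \<epsilon> powr (1 + b) \<le> kappa a b * max (s powr a) ((s + \<epsilon>) powr a)"
    unfolding V k[symmetric]
    by (intro divide_right_mono wint_diagonal_bounds a b1 assms c)+
qed

lemma V_asymptotic:
  assumes "0 < s"
  shows "((\<lambda>\<epsilon>. V \<epsilon> s / \<epsilon> powr (1 + b)) \<longlongrightarrow> kappa a b * s powr a) (at_right 0)"
proof (rule tendsto_sandwich)
  have e: "\<forall>\<^sub>F \<epsilon>::real in at_right 0. 0 < \<epsilon>" by (simp add: eventually_at_right_less)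
  show "\<forall>\<^sub>F \<epsilon> in at_right 0. kappa a b * min (s powr a) ((s + \<epsilon>) powr a) \<le> V \<epsilon> s / \<epsilon> powr (1 + b)"
    using e by eventually_elim (rule V_bounds[OF assms])
  show "\<forall>\<^sub>F \<epsilon> in at_right 0. V \<epsilon> s / \<epsilon> powr (1 + b) \<le> kappa a b * max (s powr a) ((s + \<epsilon>) powr a)"
    using e by eventually_elim (rule V_bounds[OF assms])
  have l: "((\<lambda>\<epsilon>. (s + \<epsilon>) powr a) \<longlongrightarrow> (s + 0) powr a) (at_right 0)"
    using assms by (intro tendsto_intros) auto
  show "((\<lambda>\<epsilon>. kappa a b * min (s powr a) ((s + \<epsilon>) powr a)) \<longlongrightarrow> kappa a b * s powr a) (at_right 0)"
    using tendsto_mult_left[OF tendsto_min[OF tendsto_const l], of "kappa a b" "s powr a"] by simp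
  show "((\<lambda>\<epsilon>. kappa a b * max (s powr a) ((s + \<epsilon>) powr a)) \<longlongrightarrow> kappa a b * s powr a) (at_right 0)"
    using tendsto_mult_left[OF tendsto_max[OF tendsto_const l], of "kappa a b" "s powr a"] by simp
qed

text \<open>
  For \<open>\<epsilon> \<le> s\<close> the interval \<open>[s, s+\<epsilon>]\<close> lies in \<open>[s, 2s]\<close>, where \<open>u\<^sup>a\<close> is comparable to \<open>s\<^sup>a\<close>
  whatever the sign of \<open>a\<close>.
\<close>

lemma V_dominated:
  assumes "0 < \<epsilon>" "\<epsilon> \<le> s"
  shows "V \<epsilon> s / \<epsilon> powr (1 + b) \<le> kappa a b * 2 powr \<bar>a\<bar> * s powr a"
proof -
  have s: "0 < s" using assms by simp
  have "u powr a \<le> 2 powr \<bar>a\<bar> * s powr a" if "s \<le> u" "u \<le> 2 * s" for u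
  proof (cases "0 \<le> a")
    case True
    then have "u powr a \<le> (2 * s) powr a" using that s by (intro powr_mono2) auto
    then show ?thesis using True s by (simp add: powr_mult)
  next
    case False
    then have "u powr a \<le> 1 * s powr a" using that s by (auto intro!: powr_mono2')
    also have "\<dots> \<le> 2 powr \<bar>a\<bar> * s powr a" by (intro mult_right_mono ge_one_powr_ge_zero) auto
    finally show ?thesis .
  qed
  from this[of s] this[of "s + \<epsilon>"]
  have "max (s powr a) ((s + \<epsilon>) powr a) \<le> 2 powr \<bar>a\<bar> * s powr a" using assms by simp
  then have "kappa a b * max (s powr a) ((s + \<epsilon>) powr a) \<le> kappa a b * (2 powr \<bar>a\<bar> * s powr a)"
    using kappa_pos by (intro mult_left_mono) auto
  with V_bounds(2)[OF s assms(1)] show ?thesis unfolding mult.assoc by (rule order_trans)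
qed

text \<open>A covariance of order \<open>\<epsilon>\<^sup>2\<close> is compared with \<open>\<epsilon>\<^bsup>1+b\<^esup>\<close>, so the rate is \<open>\<epsilon>\<^bsup>1-b\<^esup>\<close>.\<close>

lemma C_asymptotic:
  assumes "0 < r" "r < s"
  shows "((\<lambda>\<epsilon>. C \<epsilon> s r / \<epsilon> powr (1 + b)) \<longlongrightarrow> 0) (at_right 0)"
proof (rule tendsto_rabs_zero_cancel)
  define d where "d = (s - r) / 2"
  define K where "K = max (r powr a) ((r + 1) powr a) * (\<bar>b\<bar> * d powr (b - 1)) / (2 * Beta (a + 1) (b + 1))"
  have d: "0 < d" "s = r + 2 * d" using assms by (auto simp: d_def field_simps)
  have "\<forall>\<^sub>F \<epsilon> in at_right 0. \<epsilon> \<in> {0<..<min d 1}"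
    using d by (intro eventually_at_right_real) auto
  then have *: "\<forall>\<^sub>F \<epsilon> in at_right 0. \<bar>C \<epsilon> s r / \<epsilon> powr (1 + b)\<bar> \<le> K * \<epsilon> powr (1 - b)"
  proof eventually_elim
    case (elim \<epsilon>)
    then have \<epsilon>: "0 < \<epsilon>" "\<epsilon> \<le> d" "\<epsilon> \<le> 1" by auto
    have "\<bar>C \<epsilon> s r\<bar> \<le> K * \<epsilon>\<^sup>2"
      using wint_offdiagonal_bound[OF a b1 b2 assms(1) d \<epsilon>] Beta_pos assms \<epsilon> d
      by (simp add: C_eq_wint K_def abs_divide divide_right_mono)
    moreover have "\<epsilon>\<^sup>2 = \<epsilon> powr (1 - b) * \<epsilon> powr (1 + b)"
      using \<epsilon> by (simp flip: powr_add)
    ultimately show ?case using \<epsilon> by (simp add: divide_le_eq mult_ac)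
  qed
  have "((\<lambda>\<epsilon>. K * \<epsilon> powr (1 - b)) \<longlongrightarrow> K * 0 powr (1 - b)) (at_right 0)"
    using b2 eventually_at_right_less[of "0::real"]
    by (intro tendsto_intros tendsto_powr') (auto elim: eventually_mono)
  then have "((\<lambda>\<epsilon>. K * \<epsilon> powr (1 - b)) \<longlongrightarrow> 0) (at_right 0)" by simp
  from tendsto_sandwich[OF _ * tendsto_const[of 0] this]
  show "((\<lambda>\<epsilon>. \<bar>C \<epsilon> s r / \<epsilon> powr (1 + b)\<bar>) \<longlongrightarrow> 0) (at_right 0)" by simp
qed

section \<open>Mean and variance of the approximations\<close>

definition weight :: "real \<Rightarrow> real \<Rightarrow> real \<Rightarrow> real" where
  "weight \<epsilon> t s = indicator {\<epsilon>..t + \<epsilon>} s * ((1 + a + b) / \<epsilon> powr (1 + b) * s powr b)"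

lemma weight_measurable[measurable]: "weight \<epsilon> t \<in> borel_measurable borel"
  unfolding weight_def by measurable

lemma weight_nonneg: "0 \<le> weight \<epsilon> t s"
  using ab1 by (simp add: weight_def)

lemma J_eq:
  assumes "0 < \<epsilon>"
  shows "J_approx a b B (\<lambda>x. x) \<epsilon> t \<omega> = (\<integral>s. weight \<epsilon> t s * (incr \<epsilon> s \<omega>)\<^sup>2 \<partial>lborel)"
  unfolding J_approx_def set_lebesgue_integral_def integral_mult_right_zero[symmetric]
  using assms
  by (intro Bochner_Integration.integral_cong)
    (auto simp: weight_def incr_def indicator_def power2_eq_square max_absorb2)

definition majorant :: "real \<Rightarrow> real \<Rightarrow> real" where
  "majorant t s = (1 + a + b) * (kappa a b * 2 powr \<bar>a\<bar>) * (indicator {0..t + 1} s * s powr (a + b))"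

lemma powr_indicator_integral:
  assumes "0 \<le> t"
  shows "has_bochner_integral lborel (\<lambda>s. indicator {0..t} s * s powr (a + b)) (t powr (1 + a + b) / (1 + a + b))"
  using has_integral_powr_from_0[of "a + b" t] assms ab1
  by (intro has_bochner_integral_of_nonneg) (auto simp: add_ac)

lemma majorant_integrable: "0 \<le> t \<Longrightarrow> integrable lborel (majorant t)"
  unfolding majorant_def using powr_indicator_integral[of "t + 1"]
  by (intro integrable_mult_right) (auto intro: integrable.intros)

text \<open>
  The bound is uniform in \<open>\<epsilon>\<close> and is used twice: directly for the mean, and in both variables for
  the variance.
\<close>

lemma weight_V_le_majorant:
  assumes "0 < \<epsilon>" "\<epsilon> < 1"
  shows "weight \<epsilon> t s * V \<epsilon> s \<le> majorant t s"
proof (cases "s \<in> {\<epsilon>..t + \<epsilon>}")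
  case False
  then show ?thesis using ab1 kappa_pos by (simp add: weight_def majorant_def)
next
  case True
  then have s: "\<epsilon> \<le> s" "s \<in> {0..t + 1}" using assms by auto
  have "weight \<epsilon> t s * V \<epsilon> s = (1 + a + b) * s powr b * (V \<epsilon> s / \<epsilon> powr (1 + b))"
    using True by (simp add: weight_def)
  also have "\<dots> \<le> (1 + a + b) * s powr b * (kappa a b * 2 powr \<bar>a\<bar> * s powr a)"
    using ab1 by (intro mult_left_mono V_dominated assms s) auto
  also have "\<dots> = majorant t s" using s assms by (simp add: majorant_def powr_add)
  finally show ?thesis .
qed

lemma V_measurable:
  assumes "0 \<le> \<epsilon>"
  shows "V \<epsilon> \<in> borel_measurable borel"
proof -
  note [measurable] = incr_jointly_measurable[OF assms]
  show ?thesis unfolding V_def[abs_def] by measurable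
qed

lemma weight_V_integrable:
  assumes "0 < \<epsilon>" "\<epsilon> < 1" "0 \<le> t"
  shows "integrable lborel (\<lambda>s. weight \<epsilon> t s * V \<epsilon> s)"
proof (rule Bochner_Integration.integrable_bound[OF majorant_integrable[OF assms(3)]])
  have [measurable]: "V \<epsilon> \<in> borel_measurable borel" using assms by (intro V_measurable) simp
  show "(\<lambda>s. weight \<epsilon> t s * V \<epsilon> s) \<in> borel_measurable lborel" by measurable
  have "\<bar>weight \<epsilon> t s * V \<epsilon> s\<bar> \<le> \<bar>majorant t s\<bar>" for s
    using weight_V_le_majorant[OF assms(1,2), of t s] weight_nonneg[of \<epsilon> t s] V_nonneg[of \<epsilon> s] by simp
  then show "AE s in lborel. norm (weight \<epsilon> t s * V \<epsilon> s) \<le> norm (majorant t s)" by simp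
qed

lemma J_moments:
  assumes "0 < \<epsilon>" "\<epsilon> < 1" "0 \<le> t"
  defines "J \<equiv> J_approx a b B (\<lambda>x. x) \<epsilon> t"
  shows "integrable M (\<lambda>\<omega>. (J \<omega>)\<^sup>2)"
    and "expectation J = (\<integral>s. weight \<epsilon> t s * V \<epsilon> s \<partial>lborel)"
    and "variance J = (\<integral>(s, r). 2 * (weight \<epsilon> t s * weight \<epsilon> t r * (C \<epsilon> s r)\<^sup>2) \<partial>(lborel \<Otimes>\<^sub>M lborel))"
    and "integrable (lborel \<Otimes>\<^sub>M lborel) (\<lambda>(s, r). weight \<epsilon> t s * weight \<epsilon> t r * (C \<epsilon> s r)\<^sup>2)"
proof -
  have J: "J = (\<lambda>\<omega>. \<integral>s. weight \<epsilon> t s * (incr \<epsilon> s \<omega>)\<^sup>2 \<partial>lborel)"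
    unfolding J_def J_eq[OF assms(1)] ..
  have \<epsilon>: "0 \<le> \<epsilon>" using assms by simp
  note m = weighted_quadratic_functional_moments
    [where X="incr \<epsilon>" and p="weight \<epsilon> t" and V="V \<epsilon>" and C="C \<epsilon>",
     OF prob_space_axioms incr_jointly_measurable[OF \<epsilon>] weight_measurable weight_nonneg V_def[symmetric]
      incr_square_integrable[OF \<epsilon>] C_def[symmetric] incr_isserlis(1)[OF \<epsilon>] incr_isserlis(2)[OF \<epsilon>]
      incr_isserlis(3)[OF \<epsilon>, folded V_def C_def] weight_V_integrable[OF assms(1-3)]]
  show "integrable M (\<lambda>\<omega>. (J \<omega>)\<^sup>2)"
    and "expectation J = (\<integral>s. weight \<epsilon> t s * V \<epsilon> s \<partial>lborel)"
    and "variance J = (\<integral>(s, r). 2 * (weight \<epsilon> t s * weight \<epsilon> t r * (C \<epsilon> s r)\<^sup>2) \<partial>(lborel \<Otimes>\<^sub>M lborel))"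
    and "integrable (lborel \<Otimes>\<^sub>M lborel) (\<lambda>(s, r). weight \<epsilon> t s * weight \<epsilon> t r * (C \<epsilon> s r)\<^sup>2)"
    unfolding J by (fact m)+
qed

text \<open>
  The pointwise limit of the integrand is \<open>(1+a+b) \<kappa> s\<^bsup>a+b\<^esup>\<close> on \<open>(0, t)\<close> and 0 outside \<open>[0, t]\<close>;
  the two endpoints form a null set.
\<close>

lemma J_mean_tendsto:
  assumes "0 \<le> t"
  shows "((\<lambda>\<epsilon>. \<integral>s. weight \<epsilon> t s * V \<epsilon> s \<partial>lborel) \<longlongrightarrow> kappa a b * t powr (1 + a + b)) (at_right 0)"
proof -
  let ?g = "\<lambda>s. (1 + a + b) * kappa a b * (indicator {0..t} s * s powr (a + b))"
  have "((\<lambda>\<epsilon>. \<integral>s. weight \<epsilon> t s * V \<epsilon> s \<partial>lborel) \<longlongrightarrow> (\<integral>s. ?g s \<partial>lborel)) (at_right 0)"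
  proof (rule dominated_convergence_at_right_0[OF _ _ majorant_integrable[OF assms]])
    fix \<epsilon> :: real assume \<epsilon>: "0 < \<epsilon>" "\<epsilon> < 1"
    have [measurable]: "V \<epsilon> \<in> borel_measurable borel" using \<epsilon> by (intro V_measurable) simp
    show "(\<lambda>s. weight \<epsilon> t s * V \<epsilon> s) \<in> borel_measurable lborel" by measurable
    show "norm (weight \<epsilon> t s * V \<epsilon> s) \<le> majorant t s" for s
      using weight_V_le_majorant[OF \<epsilon>, of t s] weight_nonneg[of \<epsilon> t s] V_nonneg[of \<epsilon> s] by simp
  next
    show "AE s in lborel. ((\<lambda>\<epsilon>. weight \<epsilon> t s * V \<epsilon> s) \<longlongrightarrow> ?g s) (at_right 0)"
      using AE_lborel_singleton[of 0] AE_lborel_singleton[of t]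
    proof eventually_elim
      case (elim s)
      consider "s < 0" | "0 < s" "s < t" | "0 < s" "t < s" using elim by linarith
      then show ?case
      proof cases
        case 1
        have "\<forall>\<^sub>F \<epsilon> in at_right 0. weight \<epsilon> t s * V \<epsilon> s = ?g s"
          using eventually_at_right_less[of 0]
          by eventually_elim (use 1 in \<open>auto simp: weight_def indicator_def\<close>)
        then show ?thesis by (rule tendsto_eventually)
      next
        case 2
        have "\<forall>\<^sub>F \<epsilon> in at_right 0. \<epsilon> \<in> {0<..<s}" using 2 by (intro eventually_at_right_real) auto
        then have eq: "\<forall>\<^sub>F \<epsilon> in at_right 0. (1 + a + b) * s powr b * (V \<epsilon> s / \<epsilon> powr (1 + b)) = weight \<epsilon> t s * V \<epsilon> s"
          by eventually_elim (use 2 in \<open>auto simp: weight_def indicator_def\<close>)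
        have "((\<lambda>\<epsilon>. (1 + a + b) * s powr b * (V \<epsilon> s / \<epsilon> powr (1 + b))) \<longlongrightarrow>
            (1 + a + b) * s powr b * (kappa a b * s powr a)) (at_right 0)"
          by (intro tendsto_mult_left V_asymptotic 2)
        from Lim_transform_eventually[OF this eq] show ?thesis
          using 2 by (simp add: powr_add mult_ac)
      next
        case 3
        have "\<forall>\<^sub>F \<epsilon> in at_right 0. \<epsilon> \<in> {0<..<s - t}" using 3 by (intro eventually_at_right_real) auto
        then have "\<forall>\<^sub>F \<epsilon> in at_right 0. weight \<epsilon> t s * V \<epsilon> s = ?g s"
          by eventually_elim (use 3 in \<open>auto simp: weight_def indicator_def\<close>)
        then show ?thesis by (rule tendsto_eventually)
      qed
    qed
  qed measurable
  also have "(\<integral>s. ?g s \<partial>lborel) = kappa a b * t powr (1 + a + b)"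
    using powr_indicator_integral[OF assms] ab1 by (simp add: has_bochner_integral_iff)
  finally show ?thesis .
qed

text \<open>
  Each weight carries one factor \<open>\<epsilon>\<^bsup>-(1+b)\<^esup>\<close>, which is exactly what normalises the two factors of
  the squared covariance.
\<close>

lemma weighted_C_square_tendsto:
  assumes "s \<noteq> r"
  shows "((\<lambda>\<epsilon>. weight \<epsilon> t s * weight \<epsilon> t r * (C \<epsilon> s r)\<^sup>2) \<longlongrightarrow> 0) (at_right 0)"
proof (cases "0 < s \<and> 0 < r")
  case False
  have "\<forall>\<^sub>F \<epsilon> in at_right 0. weight \<epsilon> t s * weight \<epsilon> t r * (C \<epsilon> s r)\<^sup>2 = 0"
    using eventually_at_right_less[of 0]
    by eventually_elim (use False in \<open>auto simp: weight_def indicator_def\<close>)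
  then show ?thesis by (rule tendsto_eventually)
next
  case True
  let ?c = "(1 + a + b)\<^sup>2 * s powr b * r powr b"
  have C0: "((\<lambda>\<epsilon>. C \<epsilon> s r / \<epsilon> powr (1 + b)) \<longlongrightarrow> 0) (at_right 0)"
    using C_asymptotic[of r s] C_asymptotic[of s r] True assms
    by (cases "r < s") (auto simp: C_commute[of _ s r])
  show ?thesis
  proof (rule tendsto_sandwich)
    show "\<forall>\<^sub>F \<epsilon> in at_right 0. 0 \<le> weight \<epsilon> t s * weight \<epsilon> t r * (C \<epsilon> s r)\<^sup>2"
      using weight_nonneg by simp
    show "\<forall>\<^sub>F \<epsilon> in at_right 0. weight \<epsilon> t s * weight \<epsilon> t r * (C \<epsilon> s r)\<^sup>2 \<le> ?c * (C \<epsilon> s r / \<epsilon> powr (1 + b))\<^sup>2"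
    proof (rule always_eventually, rule allI)
      fix \<epsilon>
      let ?q = "\<lambda>s. (1 + a + b) / \<epsilon> powr (1 + b) * s powr b"
      have "weight \<epsilon> t s * weight \<epsilon> t r * (C \<epsilon> s r)\<^sup>2 \<le> ?q s * ?q r * (C \<epsilon> s r)\<^sup>2"
        using ab1 by (intro mult_right_mono mult_mono) (auto simp: weight_def indicator_def)
      also have "\<dots> = ?c * (C \<epsilon> s r / \<epsilon> powr (1 + b))\<^sup>2"
        by (simp add: power2_eq_square)
      finally show "weight \<epsilon> t s * weight \<epsilon> t r * (C \<epsilon> s r)\<^sup>2 \<le> ?c * (C \<epsilon> s r / \<epsilon> powr (1 + b))\<^sup>2" .
    qed
    show "((\<lambda>\<epsilon>. ?c * (C \<epsilon> s r / \<epsilon> powr (1 + b))\<^sup>2) \<longlongrightarrow> 0) (at_right 0)"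
      using tendsto_mult_left[OF tendsto_power[OF C0, of 2], of ?c] by simp
  qed simp
qed

lemma J_variance_tendsto:
  assumes t: "0 \<le> t"
  shows "((\<lambda>\<epsilon>. \<integral>(s, r). 2 * (weight \<epsilon> t s * weight \<epsilon> t r * (C \<epsilon> s r)\<^sup>2) \<partial>(lborel \<Otimes>\<^sub>M lborel)) \<longlongrightarrow> 0) (at_right 0)"
proof -
  let ?P = "lborel \<Otimes>\<^sub>M lborel :: (real \<times> real) measure"
  let ?f = "\<lambda>\<epsilon> (s, r). 2 * (weight \<epsilon> t s * weight \<epsilon> t r * (C \<epsilon> s r)\<^sup>2)"
  have "((\<lambda>\<epsilon>. integral\<^sup>L ?P (?f \<epsilon>)) \<longlongrightarrow> (\<integral>x. 0 \<partial>?P)) (at_right 0)"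
  proof (rule dominated_convergence_at_right_0)
    show "integrable ?P (\<lambda>x. 2 * (case x of (s, r) \<Rightarrow> majorant t s * majorant t r))"
      by (intro integrable_mult_right integrable_product_kernel majorant_integrable t)
  next
    fix \<epsilon> :: real assume \<epsilon>: "0 < \<epsilon>" "\<epsilon> < 1"
    have "integrable ?P (\<lambda>x. 2 * (case x of (s, r) \<Rightarrow> weight \<epsilon> t s * weight \<epsilon> t r * (C \<epsilon> s r)\<^sup>2))"
      using \<epsilon> t by (intro integrable_mult_right J_moments(4)) auto
    then show "?f \<epsilon> \<in> borel_measurable ?P" by (simp add: split_beta')
    show "norm (?f \<epsilon> x) \<le> 2 * (case x of (s, r) \<Rightarrow> majorant t s * majorant t r)" for x
    proof (cases x)
      case (Pair s r)
      have "weight \<epsilon> t s * weight \<epsilon> t r * (C \<epsilon> s r)\<^sup>2 \<le> weight \<epsilon> t s * weight \<epsilon> t r * (V \<epsilon> s * V \<epsilon> r)"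
        using \<epsilon> weight_nonneg by (intro mult_left_mono C_square_le) auto
      also have "\<dots> = (weight \<epsilon> t s * V \<epsilon> s) * (weight \<epsilon> t r * V \<epsilon> r)" by simp
      also have "\<dots> \<le> majorant t s * majorant t r"
        using weight_nonneg V_nonneg weight_V_le_majorant[OF \<epsilon>]
        by (intro mult_mono' mult_nonneg_nonneg) auto
      finally show ?thesis using Pair weight_nonneg by simp
    qed
  next
    show "AE x in ?P. ((\<lambda>\<epsilon>. ?f \<epsilon> x) \<longlongrightarrow> 0) (at_right 0)"
      using AE_lborel_pair_distinct
    proof eventually_elim
      case (elim x)
      then show ?case
        using tendsto_mult_left[OF weighted_C_square_tendsto[of "fst x" "snd x" t], of 2] by (simp add: split_beta')
    qed
  qed simp
  then show ?thesis by simp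
qed

section \<open>The quadratic covariation\<close>

lemma J_measurable:
  assumes "0 < \<epsilon>"
  shows "J_approx a b B (\<lambda>x. x) \<epsilon> t \<in> borel_measurable M"
proof -
  note [measurable] = incr_jointly_measurable[OF less_imp_le[OF assms]]
  show ?thesis unfolding J_eq[OF assms, abs_def] by measurable
qed

text \<open>
  Once the mean is within \<open>\<delta>/2\<close> of the limit, a deviation by more than \<open>\<delta>\<close> from the limit is a
  deviation by at least \<open>\<delta>/2\<close> from the mean, to which Chebyshev's inequality applies.
\<close>

lemma J_tendsto_in_probability:
  assumes t: "0 \<le> t" and \<delta>: "0 < \<delta>"
  shows "((\<lambda>\<epsilon>. prob {\<omega> \<in> space M. \<bar>J_approx a b B (\<lambda>x. x) \<epsilon> t \<omega> - kappa a b * t powr (1 + a + b)\<bar> > \<delta>})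
    \<longlongrightarrow> 0) (at_right 0)"
proof -
  let ?J = "\<lambda>\<epsilon>. J_approx a b B (\<lambda>x. x) \<epsilon> t" and ?L = "kappa a b * t powr (1 + a + b)"
  let ?m = "\<lambda>\<epsilon>. \<integral>s. weight \<epsilon> t s * V \<epsilon> s \<partial>lborel"
  let ?v = "\<lambda>\<epsilon>. \<integral>(s, r). 2 * (weight \<epsilon> t s * weight \<epsilon> t r * (C \<epsilon> s r)\<^sup>2) \<partial>(lborel \<Otimes>\<^sub>M lborel)"
  have near: "\<forall>\<^sub>F \<epsilon> in at_right 0. \<bar>?m \<epsilon> - ?L\<bar> < \<delta> / 2"
    using tendstoD[OF J_mean_tendsto[OF t], of "\<delta> / 2"] \<delta> by (simp add: dist_real_def)
  have small: "\<forall>\<^sub>F \<epsilon>::real in at_right 0. \<epsilon> \<in> {0<..<1}"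
    by (intro eventually_at_right_real) simp
  have *: "\<forall>\<^sub>F \<epsilon> in at_right 0. prob {\<omega> \<in> space M. \<bar>?J \<epsilon> \<omega> - ?L\<bar> > \<delta>} \<le> ?v \<epsilon> / (\<delta> / 2)\<^sup>2"
    using near small
  proof eventually_elim
    case (elim \<epsilon>)
    then have \<epsilon>: "0 < \<epsilon>" "0 \<le> \<epsilon>" "\<epsilon> < 1" by auto
    have [measurable]: "?J \<epsilon> \<in> borel_measurable M" by (rule J_measurable[OF \<epsilon>(1)])
    note moments = J_moments[OF \<epsilon>(1,3) t]
    have "prob {\<omega> \<in> space M. \<bar>?J \<epsilon> \<omega> - ?L\<bar> > \<delta>} \<le> prob {\<omega> \<in> space M. \<bar>?J \<epsilon> \<omega> - expectation (?J \<epsilon>)\<bar> \<ge> \<delta> / 2}"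
    proof (rule finite_measure_mono)
      show "{\<omega> \<in> space M. \<bar>?J \<epsilon> \<omega> - ?L\<bar> > \<delta>} \<subseteq> {\<omega> \<in> space M. \<bar>?J \<epsilon> \<omega> - expectation (?J \<epsilon>)\<bar> \<ge> \<delta> / 2}"
      proof safe
        fix \<omega> assume "\<bar>?J \<epsilon> \<omega> - ?L\<bar> > \<delta>"
        then show "\<bar>?J \<epsilon> \<omega> - expectation (?J \<epsilon>)\<bar> \<ge> \<delta> / 2"
          using elim(1) unfolding moments(2)[symmetric] by linarith
      qed
    qed measurable
    also have "\<dots> \<le> variance (?J \<epsilon>) / (\<delta> / 2)\<^sup>2"
      using \<delta> by (intro Chebyshev_inequality moments) auto
    finally show ?case unfolding moments(3) .
  qed
  have "((\<lambda>\<epsilon>. ?v \<epsilon> / (\<delta> / 2)\<^sup>2) \<longlongrightarrow> 0) (at_right 0)"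
    using tendsto_divide[OF J_variance_tendsto[OF t] tendsto_const, of "(\<delta> / 2)\<^sup>2"] \<delta> by simp
  from tendsto_sandwich[OF _ * tendsto_const[of 0] this] show ?thesis by simp
qed

lemma J_integrand_continuous:
  assumes "0 < \<epsilon>" "\<omega> \<in> space M"
  shows "continuous_on {\<epsilon>..T} (\<lambda>s. (B (s + \<epsilon>) \<omega> - B s \<omega>) * (B (s + \<epsilon>) \<omega> - B s \<omega>) * s powr b)"
  using assms(1)
  by (intro continuous_intros continuous_on_compose2[OF B_continuous[OF assms(2)]]) auto

lemma J_eq_integral:
  assumes "0 < \<epsilon>" "\<omega> \<in> space M"
  shows "J_approx a b B (\<lambda>x. x) \<epsilon> t \<omega> = (1 + a + b) / \<epsilon> powr (1 + b) *
    integral {\<epsilon>..t + \<epsilon>} (\<lambda>s. (B (s + \<epsilon>) \<omega> - B s \<omega>) * (B (s + \<epsilon>) \<omega> - B s \<omega>) * s powr b)"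
  unfolding J_approx_def
  using set_borel_integral_eq_integral(2)[OF borel_integrable_atLeastAtMost'[OF J_integrand_continuous[OF assms]]]
  by simp

text \<open>For \<open>f(x) = x\<close> the integrand is a square times a power, hence nonnegative.\<close>

lemma J_mono:
  assumes "0 < \<epsilon>" "\<omega> \<in> space M" "s \<le> t"
  shows "J_approx a b B (\<lambda>x. x) \<epsilon> s \<omega> \<le> J_approx a b B (\<lambda>x. x) \<epsilon> t \<omega>"
  unfolding J_eq_integral[OF assms(1,2)]
  using ab1 assms
  by (intro mult_left_mono integral_subset_le integrable_continuous_interval J_integrand_continuous) auto

lemma J_continuous:
  assumes "0 < \<epsilon>" "\<omega> \<in> space M"
  shows "continuous_on {0..T} (\<lambda>t. J_approx a b B (\<lambda>x. x) \<epsilon> t \<omega>)"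
  unfolding J_eq_integral[OF assms]
proof (intro continuous_on_mult_left)
  let ?f = "\<lambda>s. (B (s + \<epsilon>) \<omega> - B s \<omega>) * (B (s + \<epsilon>) \<omega> - B s \<omega>) * s powr b"
  have "continuous_on {\<epsilon>..T + \<epsilon>} (\<lambda>u. integral {\<epsilon>..u} ?f)"
    by (intro indefinite_integral_continuous_1 integrable_continuous_interval J_integrand_continuous assms)
  then show "continuous_on {0..T} (\<lambda>t. integral {\<epsilon>..t + \<epsilon>} ?f)"
    by (rule continuous_on_compose2) (auto intro!: continuous_intros)
qed

lemma quadratic_covariation:
  "has_gen_quad_cov a b M B (\<lambda>x. x) (\<lambda>t \<omega>. kappa a b * t powr (1 + a + b))"
  unfolding has_gen_quad_cov_def
proof
  show "ucp_limit M (J_approx a b B (\<lambda>x. x)) (\<lambda>t \<omega>. kappa a b * t powr (1 + a + b))"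
  proof (rule ucp_limit_of_mono[OF prob_space_axioms])
    show "continuous_on {0..T} (\<lambda>t. kappa a b * t powr (1 + a + b))" for T
      using ab1 by (intro continuous_intros continuous_on_powr') auto
  qed (simp_all add: J_measurable J_continuous J_mono J_tendsto_in_probability)
qed simp

end

theorem proposition4p1:
  fixes a b :: real and M :: "'a measure" and B :: "real \<Rightarrow> 'a \<Rightarrow> real"
  assumes "prob_space M"
    and "a > -1" and "\<bar>b\<bar> < 1" and "\<bar>b\<bar> < 1 + a"
    and "weighted_fBm a b M B"
  shows "has_gen_quad_cov a b M B (\<lambda>x. x) (\<lambda>t \<omega>. kappa a b * t powr (1 + a + b))"
proof -
  interpret weighted_fBm_process M a b B
    using assms by (simp add: weighted_fBm_process_def weighted_fBm_process_axioms_def)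
  show ?thesis by (rule quadratic_covariation)
qed

end
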